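(* Let $n\ge 3$ be odd. The subgroup $\mathbf{E}_S$ of the $n\times n\times n$ Rubik's Cube group $\mathbf{G}$ consisting of the elements that fix every sticker not lying on a single edge cubie and leave every single edge orientation equal to $0$ (when applied to the solved cube) is isomorphic to the alternating group $\mathcal{A}_{12}$ (via its action on the 12 single-edge positions).
   Context: The $n\times n\times n$ Rubik's Cube has faces U, D, F, B, R, L, each an $n\times n$ grid of facelets carrying stickers ($6n^2$ in total); in the solved state each face is monochromatic with six distinct colors. For $1\le k\le\lfloor n/2\rfloor$, $F_k,B_k,R_k,L_k,U_k,D_k$ denote clockwise (seen from the named face) $90^\circ$ rotations of the $k$-th $n\times n\times 1$ slice counted from the named face. $\mathbf{G}$ is the subgroup of the symmetric group on the facelets generated by the facelet permutations induced by these moves. Along each of the 12 edges of the big cube lie edge cubies (two stickers) at positions $2,\dots,n-1$; for odd $n$ the one at position $(n+1)/2$ is a single edge (12 in total). Single edge orientation: one of the two facelets of each single-edge position is fixed as reference facelet (a fixed choice for which all single edges have orientation $0$ in the solved state); a single edge cubie has orientation $0$ iff its sticker that lay on a reference facelet in the solved state lies on a reference facelet, and $1$ otherwise. *)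

theory Defs
  imports "HOL-Algebra.Sym_Groups"
begin

text \<open>The library's \<open>sym_group\<close> and \<open>alt_group\<close>, with \<open>{1..n}\<close> replaced by an arbitrary set.\<close>

definition sym_group_on :: "'a set \<Rightarrow> ('a \<Rightarrow> 'a) monoid" where
  "sym_group_on S = \<lparr>carrier = {p. p permutes S}, mult = (\<circ>), one = id\<rparr>"

definition alt_group_on :: "'a set \<Rightarrow> ('a \<Rightarrow> 'a) monoid" where
  "alt_group_on S = (sym_group_on S)\<lparr>carrier := {p. p permutes S \<and> evenperm p}\<rparr>"

text \<open>
  The big cube is \<open>[-n, n]\<^sup>3\<close> and every cubie has side length 2, so that all the centres
  below have integer coordinates. The \<open>x\<close>-axis points to the right, the \<open>y\<close>-axis up and
  the \<open>z\<close>-axis to the front. A facelet is represented by its centre.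
\<close>

type_synonym point = "int \<times> int \<times> int"

datatype face = Up | Down | Front | Back | Right | Left

text \<open>The coordinate along a cube axis of the centres of the cubies at positions \<open>1, \<dots>, n\<close>.\<close>

definition cubie_coords :: "nat \<Rightarrow> int set" where
  "cubie_coords n = (\<lambda>i. 2 * int i - int n - 1) ` {1..n}"

definition facelets :: "nat \<Rightarrow> point set" where
  "facelets n = {(x, y, z).
     \<bar>x\<bar> = int n \<and> y \<in> cubie_coords n \<and> z \<in> cubie_coords n \<or>
     x \<in> cubie_coords n \<and> \<bar>y\<bar> = int n \<and> z \<in> cubie_coords n \<or>
     x \<in> cubie_coords n \<and> y \<in> cubie_coords n \<and> \<bar>z\<bar> = int n}"

text \<open>The component of a point in the direction of the outward normal of a face.\<close>

fun height :: "face \<Rightarrow> point \<Rightarrow> int" where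
  "height Up (x, y, z) = y"
| "height Down (x, y, z) = - y"
| "height Front (x, y, z) = z"
| "height Back (x, y, z) = - z"
| "height Right (x, y, z) = x"
| "height Left (x, y, z) = - x"

text \<open>
  Clockwise quarter turns, seen from the named face. For example \<open>Right\<close> sends the front
  face to the upper face, and the upper face to the back face.
\<close>

fun quarter_turn :: "face \<Rightarrow> point \<Rightarrow> point" where
  "quarter_turn Up (x, y, z) = (- z, y, x)"
| "quarter_turn Down (x, y, z) = (z, y, - x)"
| "quarter_turn Front (x, y, z) = (y, - x, z)"
| "quarter_turn Back (x, y, z) = (- y, x, z)"
| "quarter_turn Right (x, y, z) = (x, z, - y)"
| "quarter_turn Left (x, y, z) = (x, - z, y)"

text \<open>
  The \<open>k\<close>-th slice counted from face \<open>s\<close> is the slab of heights \<open>n - 2k\<close> to \<open>n - 2k + 2\<close>.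
  It contains the facelets of the face \<open>s\<close> itself precisely for \<open>k = 1\<close>.
\<close>

definition slice_facelets :: "nat \<Rightarrow> face \<Rightarrow> nat \<Rightarrow> point set" where
  "slice_facelets n s k =
     {p \<in> facelets n. int n - 2 * int k \<le> height s p \<and> height s p \<le> int n - 2 * int k + 2}"

definition move :: "nat \<Rightarrow> face \<Rightarrow> nat \<Rightarrow> point \<Rightarrow> point" where
  "move n s k p = (if p \<in> slice_facelets n s k then quarter_turn s p else p)"

definition cube_group :: "nat \<Rightarrow> (point \<Rightarrow> point) monoid" where
  "cube_group n = (sym_group_on (facelets n))
     \<lparr>carrier := generate (sym_group_on (facelets n)) {move n s k | s k. 1 \<le> k \<and> k \<le> n div 2}\<rparr>"

text \<open>
  The facelets of the cubie with centre \<open>(a, b, c)\<close>: the centres of the sides of a cubie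
  are the points at distance 1 from its centre in coordinate direction.
\<close>

definition cubie_facelets :: "nat \<Rightarrow> point \<Rightarrow> point set" where
  "cubie_facelets n = (\<lambda>(a, b, c). {(x, y, z) \<in> facelets n. \<bar>x - a\<bar> + \<bar>y - b\<bar> + \<bar>z - c\<bar> = 1})"

text \<open>
  For odd \<open>n\<close>. A single-edge position is represented by the set of its two facelets; position
  \<open>(n + 1) / 2\<close> along an edge of the big cube has coordinate 0.
\<close>

definition single_edges :: "nat \<Rightarrow> point set set" where
  "single_edges n = cubie_facelets n ` {(x, y, z).
     x = 0 \<and> \<bar>y\<bar> = int n - 1 \<and> \<bar>z\<bar> = int n - 1 \<or>
     \<bar>x\<bar> = int n - 1 \<and> y = 0 \<and> \<bar>z\<bar> = int n - 1 \<or>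
     \<bar>x\<bar> = int n - 1 \<and> \<bar>y\<bar> = int n - 1 \<and> z = 0}"

text \<open>
  A permutation \<open>g\<close> of the facelets, applied to the solved cube, brings the sticker that lay on
  facelet \<open>f\<close> to facelet \<open>g f\<close>. The function \<open>ref\<close> selects the reference facelet of each
  single-edge position, and \<open>e\<close> is the position of the cubie in the solved state.
\<close>

definition single_edge_orientation ::
  "nat \<Rightarrow> (point set \<Rightarrow> point) \<Rightarrow> (point \<Rightarrow> point) \<Rightarrow> point set \<Rightarrow> nat" where
  "single_edge_orientation n ref g e = (if g (ref e) \<in> ref ` single_edges n then 0 else 1)"

definition single_edge_subgroup :: "nat \<Rightarrow> (point set \<Rightarrow> point) \<Rightarrow> (point \<Rightarrow> point) set" where
  "single_edge_subgroup n ref = {g \<in> carrier (cube_group n).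
     (\<forall>f \<in> facelets n - \<Union> (single_edges n). g f = f) \<and>
     (\<forall>e \<in> single_edges n. single_edge_orientation n ref g e = 0)}"

definition single_edge_action :: "nat \<Rightarrow> (point \<Rightarrow> point) \<Rightarrow> point set \<Rightarrow> point set" where
  "single_edge_action n g e = (if e \<in> single_edges n then g ` e else e)"

end

theory Submission
  imports Defs
begin

text \<open>
  A turn of an outer layer permutes the twelve single edges and the eight corners in two disjoint
  four-cycles, and turns of inner slices move neither. Hence an element that fixes all corners
  permutes the single edges evenly.

  Conversely, let \<open>N\<close> turn all slices orthogonal to the \<open>x\<close>-axis except the middle one. The conjugate
  of a turn of the front layer by \<open>N\<close> meets the bottom layer only in the single edge between the
  front and the bottom face, so its commutator with a turn of the bottom layer is a three-cycle of
  single edges that moves nothing else. Conjugating it by elements which fix two of its three edges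
  produces the three-cycles through these two edges and an arbitrary third one, in either
  orientation. These in turn yield every three-cycle of single edges with every orientation of
  total flip zero, in particular the one which respects the given reference facelets, and
  three-cycles generate the alternating group.
\<close>

section \<open>Permutation groups on arbitrary sets\<close>

lemma group_sym_group_on: "group (sym_group_on S)"
proof (rule groupI)
  fix p assume "p \<in> carrier (sym_group_on S)"
  then show "\<exists>q \<in> carrier (sym_group_on S). q \<otimes>\<^bsub>sym_group_on S\<^esub> p = \<one>\<^bsub>sym_group_on S\<^esub>"
    using permutes_inv[of p S] permutes_inv_o(2)[of p S]
    by (intro bexI[of _ "inv' p"]) (auto simp: sym_group_on_def)
qed (auto simp: sym_group_on_def permutes_compose comp_assoc)

lemma inv_sym_group_on:
  assumes "p permutes S"
  shows "inv\<^bsub>sym_group_on S\<^esub> p = inv' p"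
  by (rule group.inv_equality[OF group_sym_group_on])
     (use assms permutes_inv permutes_inv_o(2) in \<open>auto simp: sym_group_on_def\<close>)

lemma map_permutation_iso_alt_group:
  assumes f: "bij_betw f S {1..k}" and fin: "finite S"
  shows "map_permutation S f \<in> iso (alt_group_on S) (alt_group k)"
proof (rule isoI)
  note inj = bij_betw_imp_inj_on[OF f]
  show "map_permutation S f \<in> hom (alt_group_on S) (alt_group k)"
    using map_permutation_permutes[OF f] evenperm_map_permutation[OF inj _ fin]
      map_permutation_compose'[OF inj]
    by (auto simp: hom_def alt_group_on_def sym_group_on_def alt_group_def sym_group_def)
  show "bij_betw (map_permutation S f) (carrier (alt_group_on S)) (carrier (alt_group k))"
  proof (rule bij_betw_byWitness[where f' = "map_permutation {1..k} (inv_into S f)"])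
    note f' = bij_betw_inv_into[OF f]
    have fS: "f ` S = {1..k}"
      using f by (simp add: bij_betw_def)
    have left: "inv_into S f (f x) = x" if "x \<in> S" for x
      using inj that by simp
    have right: "f (inv_into S f x) = x" if "x \<in> {1..k}" for x
      using fS f_inv_into_f[of x f S] that by auto
    show "\<forall>p \<in> carrier (alt_group_on S).
        map_permutation {1..k} (inv_into S f) (map_permutation S f p) = p"
      using map_permutation_compose_inv[OF f _ left]
      by (auto simp: alt_group_on_def sym_group_on_def)
    show "\<forall>p \<in> carrier (alt_group k).
        map_permutation S f (map_permutation {1..k} (inv_into S f) p) = p"
      using map_permutation_compose_inv[OF f' _ right]
      by (auto simp: alt_group_def sym_group_def)
    show "map_permutation S f ` carrier (alt_group_on S) \<subseteq> carrier (alt_group k)"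
      using map_permutation_permutes[OF f] evenperm_map_permutation[OF inj _ fin]
      by (auto simp: alt_group_on_def sym_group_on_def alt_group_def sym_group_def)
    show "map_permutation {1..k} (inv_into S f) ` carrier (alt_group k)
        \<subseteq> carrier (alt_group_on S)"
      using map_permutation_permutes[OF f']
        evenperm_map_permutation[OF bij_betw_imp_inj_on[OF f']]
      by (auto simp: alt_group_on_def sym_group_on_def alt_group_def sym_group_def)
  qed
qed

lemma map_permutation_three_cycle:
  assumes f: "inj_on f A" and abc: "{a, b, c} \<subseteq> A"
  shows "map_permutation A f (cycle_of_list [a, b, c]) = cycle_of_list [f a, f b, f c]"
  using abc map_permutation_compose'[OF f, of "transpose b c" "transpose a b"]
  by (simp add: map_permutation_transpose[OF f] permutes_swap_id)

lemma inv_three_cycle: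
  assumes "distinct [a, b, c]"
  shows "inv' (cycle_of_list [a, b, c]) = cycle_of_list [c, b, a]"
  by (rule inv_unique_comp) (use assms in \<open>auto simp: fun_eq_iff transpose_def\<close>)

text \<open>Three-cycles generate the alternating group on \<open>{1..k}\<close>. A bijection with
  \<open>S\<close> transports this fact to an arbitrary finite set and turns it into an induction
  rule.\<close>

lemma evenperm_three_cycle_induct [consumes 3, case_names id cycle comp]:
  assumes fin: "finite S" and p: "p permutes S" "evenperm p"
    and id: "P id"
    and cycle: "\<And>a b c. {a, b, c} \<subseteq> S \<Longrightarrow> distinct [a, b, c] \<Longrightarrow> P (cycle_of_list [a, b, c])"
    and comp: "\<And>p q. P p \<Longrightarrow> P q \<Longrightarrow> P (p \<circ> q)"
  shows "P p"
proof -
  define k where "k = card S"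
  obtain f where f: "bij_betw f {1..k} S"
    using ex_bij_betw_nat_finite_1[OF fin] k_def by blast
  note inj = bij_betw_imp_inj_on[OF f]
  define g where "g = inv_into {1..k} f"
  have g: "bij_betw g S {1..k}"
    unfolding g_def by (rule bij_betw_inv_into[OF f])
  have three: "P (map_permutation {1..k} f h)" if h: "h \<in> three_cycles k" for h
  proof -
    obtain cs where cs: "h = cycle_of_list cs" "cycle cs" "length cs = 3" "set cs \<subseteq> {1..k}"
      using h by auto
    obtain a b c where abc: "cs = [a, b, c]"
      using stupid_lemma[OF cs(3)] by auto
    show ?thesis
      unfolding cs(1) abc using cs abc f
      by (subst map_permutation_three_cycle[OF inj])
         (auto intro!: cycle simp del: cycle_of_list.simps simp: inj_on_eq_iff[OF inj] bij_betw_def)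
  qed
  have gen: "P (map_permutation {1..k} f h)" if "h \<in> generate (alt_group k) (three_cycles k)" for h
    using that
  proof induction
    case one
    then show ?case
      unfolding alt_group_one map_permutation_id'[OF inj] by (rule id)
  next
    case (incl h)
    then show ?case by (rule three)
  next
    \<comment> \<open>\<open>generate\<close> adjoins inverses of generators. The inverse of a
      three-cycle is the reversed three-cycle, so \<open>three\<close> covers it as well.\<close>
    case (inv h)
    then obtain cs where cs: "h = cycle_of_list cs" "cycle cs" "length cs = 3" "set cs \<subseteq> {1..k}"
      by auto
    obtain a b c where abc: "cs = [a, b, c]"
      using stupid_lemma[OF cs(3)] by auto
    have "h \<in> carrier (alt_group k)"
      using inv three_cycles_incl by blast
    then have "inv\<^bsub>alt_group k\<^esub> h = cycle_of_list [c, b, a]"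
      using cs abc by (simp del: cycle_of_list.simps add: alt_group_inv_equality inv_three_cycle)
    then have "inv\<^bsub>alt_group k\<^esub> h \<in> three_cycles k"
      using cs abc by (auto simp del: cycle_of_list.simps intro!: exI[of _ "[c, b, a]"])
    then show ?case by (rule three)
  next
    case (eng h1 h2)
    then have "h2 \<in> carrier (alt_group k)"
      using alt_group_carrier_as_three_cycles by blast
    then have "h2 permutes {1..k}"
      by (simp add: alt_group_carrier)
    then show ?case
      unfolding alt_group_mult by (subst map_permutation_compose'[OF inj]) (use eng comp in auto)
  qed
  have "map_permutation S g p \<in> carrier (alt_group k)"
    using p map_permutation_permutes[OF g]
      evenperm_map_permutation[OF bij_betw_imp_inj_on[OF g] _ fin]
    by (auto simp: alt_group_carrier)
  then have "P (map_permutation {1..k} f (map_permutation S g p))"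
    unfolding alt_group_carrier_as_three_cycles by (rule gen)
  moreover have "f (g x) = x" if "x \<in> S" for x
    unfolding g_def using f that by (intro f_inv_into_f) (auto simp: bij_betw_def)
  then have "map_permutation {1..k} f (map_permutation S g p) = p"
    using map_permutation_compose_inv[OF g p(1)] by blast
  ultimately show ?thesis
    by simp
qed

section \<open>Simultaneous three-cycles\<close>

text \<open>With \<open>opp\<close> exchanging the two facelets of a cubie, this is a three-cycle of
  cubies. Writing \<open>opp a\<close> for \<open>a\<close> alone changes how the cubies are flipped
  on the way, so the chosen facelets encode orientations; the total flip around the cycle is always
  zero.\<close>

definition paired_cycle :: "('a \<Rightarrow> 'a) \<Rightarrow> 'a \<Rightarrow> 'a \<Rightarrow> 'a \<Rightarrow> 'a \<Rightarrow> 'a" where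
  "paired_cycle opp a b c = cycle_of_list [a, b, c] \<circ> cycle_of_list [opp a, opp b, opp c]"

text \<open>Only \<open>D\<close> is moved by both maps, and both carry it off itself. Elsewhere one
  of the two maps is idle and the other cancels against its inverse, so what survives is the cyclic
  passage from \<open>D\<close> to \<open>f\<close> D\<open>, on to\<close>g \<open>D\<close> and
  back to \<open>D\<close>.\<close>

lemma commutator_apply:
  assumes f: "bij f" and g: "bij g"
    and D: "\<And>x. f x \<noteq> x \<Longrightarrow> g x \<noteq> x \<Longrightarrow> x \<in> D"
    and out: "\<And>x. x \<in> D \<Longrightarrow> f x \<notin> D" "\<And>x. x \<in> D \<Longrightarrow> g x \<notin> D"
      "\<And>x. x \<in> D \<Longrightarrow> inv' f x \<notin> D" "\<And>x. x \<in> D \<Longrightarrow> inv' g x \<notin> D"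
  shows "(f \<circ> g \<circ> inv' f \<circ> inv' g) x =
    (if x \<in> D then f x else if inv' f x \<in> D then g (inv' f x) else if inv' g x \<in> D then inv' g x else x)"
proof -
  have ff: "f (inv' f y) = y" "inv' f (f y) = y" and gg: "g (inv' g y) = y" "inv' g (g y) = y" for y
    using f g by (simp_all add: bij_is_surj surj_f_inv_f bij_is_inj)
  note eqs = ff gg
  consider "x \<in> D" | "x \<notin> D" "inv' f x \<in> D" | "x \<notin> D" "inv' f x \<notin> D" "inv' g x \<in> D"
    | "x \<notin> D" "inv' f x \<notin> D" "inv' g x \<notin> D"
    by blast
  then show ?thesis
  proof cases
    case 1
    \<comment> \<open>The point \<open>inv' g x\<close> lies outside \<open>D\<close> and is moved
      by \<open>g\<close>, since otherwise it would equal \<open>x\<close>. Hence \<open>f\<close>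
      fixes it.\<close>
    then have "f (inv' g x) = inv' g x"
      using out D eqs by metis
    then have "inv' f (inv' g x) = inv' g x"
      using ff by metis
    then show ?thesis
      using 1 eqs by simp
  next
    case 2
    then have "inv' g x = x" "f (g (inv' f x)) = g (inv' f x)"
      using out D eqs by metis+
    then show ?thesis
      using 2 by simp
  next
    case 3
    then have "g (inv' f (inv' g x)) = inv' f (inv' g x)"
      using out D eqs by metis
    then show ?thesis
      using 3 eqs by simp
  next
    case 4
    then show ?thesis
      using D eqs by (simp, metis)
  qed
qed

text \<open>An abstract form of the cube group acting on single-edge facelets: an element of
  \<open>V\<close> is a cubie together with one of its two facelets. Members of \<open>G\<close> may
  also move points outside \<open>V\<close>, which is why bijectivity is required on the whole
  type.\<close>

locale paired_action =
  fixes V :: "'a set" and opp :: "'a \<Rightarrow> 'a" and G :: "('a \<Rightarrow> 'a) set"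
  assumes opp_in [simp]: "a \<in> V \<Longrightarrow> opp a \<in> V"
    and opp_opp [simp]: "a \<in> V \<Longrightarrow> opp (opp a) = a"
    and opp_neq [simp]: "a \<in> V \<Longrightarrow> opp a \<noteq> a"
    and G_comp: "g \<in> G \<Longrightarrow> h \<in> G \<Longrightarrow> g \<circ> h \<in> G"
    and G_inv: "g \<in> G \<Longrightarrow> inv' g \<in> G"
    and G_bij: "g \<in> G \<Longrightarrow> bij g"
    and G_in: "g \<in> G \<Longrightarrow> a \<in> V \<Longrightarrow> g a \<in> V"
    and G_opp: "g \<in> G \<Longrightarrow> a \<in> V \<Longrightarrow> g (opp a) = opp (g a)"
begin

text \<open>For facelets in \<open>V\<close> this means that they belong to different
  cubies.\<close>

definition apart :: "'a \<Rightarrow> 'a \<Rightarrow> bool" where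
  "apart a b \<longleftrightarrow> a \<in> V \<and> b \<in> V \<and> a \<noteq> b \<and> opp a \<noteq> b"

lemma opp_neq' [simp]: "a \<in> V \<Longrightarrow> a \<noteq> opp a"
  using opp_neq by metis

lemma apart_sym: "apart a b \<Longrightarrow> apart b a"
  unfolding apart_def by auto

lemma apartD:
  assumes "apart a b"
  shows "a \<in> V" "b \<in> V" "a \<noteq> b" "b \<noteq> a" "opp a \<noteq> b" "b \<noteq> opp a" "a \<noteq> opp b" "opp b \<noteq> a"
    "opp a \<noteq> opp b" "opp b \<noteq> opp a"
  using assms opp_opp unfolding apart_def by metis+

lemma apart_opp: "apart a b \<Longrightarrow> apart (opp a) b" "apart a b \<Longrightarrow> apart a (opp b)"
  using apartD[of a b] unfolding apart_def by auto

lemma apart_image: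
  assumes g: "g \<in> G" and ab: "apart a b"
  shows "apart (g a) (g b)"
  using apartD[OF ab] G_in[OF g] G_opp[OF g, of a, symmetric] bij_is_inj[OF G_bij[OF g]]
  by (simp add: apart_def inj_eq)

abbreviation T :: "'a \<Rightarrow> 'a \<Rightarrow> 'a \<Rightarrow> 'a \<Rightarrow> 'a" where
  "T \<equiv> paired_cycle opp"

text \<open>Including \<open>apart\<close> excludes degenerate triples, for which \<open>T\<close>
  need not be a three-cycle of cubies.\<close>

definition realised :: "'a \<Rightarrow> 'a \<Rightarrow> 'a \<Rightarrow> bool" where
  "realised a b c \<longleftrightarrow> apart a b \<and> apart b c \<and> apart a c \<and> T a b c \<in> G"

lemma T_apply:
  assumes "apart a b" "apart b c" "apart a c"
  shows "T a b c a = b" "T a b c b = c" "T a b c c = a"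
    "apart d a \<Longrightarrow> apart d b \<Longrightarrow> apart d c \<Longrightarrow> T a b c d = d"
  using apartD[OF assms(1)] apartD[OF assms(2)] apartD[OF assms(3)] apartD[of d]
  by (auto simp: paired_cycle_def transpose_def)

lemma realised_rotate: "realised a b c \<Longrightarrow> realised b c a"
proof -
  assume r: "realised a b c"
  then have *: "apart a b" "apart b c" "apart a c"
    by (auto simp: realised_def)
  have "T b c a = T a b c"
    using apartD[OF *(1)] apartD[OF *(2)] apartD[OF *(3)]
    by (auto simp: paired_cycle_def transpose_def fun_eq_iff)
  then show ?thesis
    using r apart_sym by (auto simp: realised_def)
qed

lemma realised_opp: "realised a b c \<Longrightarrow> realised (opp a) (opp b) (opp c)"
proof -
  assume r: "realised a b c"
  then have *: "apart a b" "apart b c" "apart a c"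
    by (auto simp: realised_def)
  have "T (opp a) (opp b) (opp c) = T a b c"
    using apartD[OF *(1)] apartD[OF *(2)] apartD[OF *(3)]
    by (auto simp: paired_cycle_def transpose_def fun_eq_iff)
  then show ?thesis
    using r apart_opp by (auto simp: realised_def)
qed

lemma realised_reverse: "realised a b c \<Longrightarrow> realised c b a"
proof -
  assume r: "realised a b c"
  then have *: "apart a b" "apart b c" "apart a c"
    by (auto simp: realised_def)
  have "inv' (T a b c) = T c b a"
    by (rule inv_unique_comp)
       (use apartD[OF *(1)] apartD[OF *(2)] apartD[OF *(3)]
        in \<open>auto simp: paired_cycle_def transpose_def fun_eq_iff\<close>)
  then show ?thesis
    using r apart_sym G_inv unfolding realised_def by metis
qed

text \<open>Conjugating a three-cycle by \<open>g\<close> relabels its entries by \<open>g\<close>;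
  since \<open>g\<close> commutes with \<open>opp\<close> on \<open>V\<close>, the opposite cycle is
  relabelled consistently.\<close>

lemma realised_image:
  assumes g: "g \<in> G" and r: "realised a b c"
  shows "realised (g a) (g b) (g c)"
proof -
  have *: "apart a b" "apart b c" "apart a c" "a \<in> V" "b \<in> V" "c \<in> V"
    using r apartD by (auto simp: realised_def)
  have bij: "bij g" by (rule G_bij[OF g])
  have conj: "transpose (g x) (g y) = g \<circ> transpose x y \<circ> inv' g" for x y
    using bij by (auto simp: fun_eq_iff transpose_def bij_inv_eq_iff bij_is_inj bij_is_surj surj_f_inv_f)
  have "T (g a) (g b) (g c) = g \<circ> T a b c \<circ> inv' g"
    unfolding paired_cycle_def G_opp[OF g *(4), symmetric] G_opp[OF g *(5), symmetric]
      G_opp[OF g *(6), symmetric]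
    using bij by (auto simp: conj fun_eq_iff bij_is_inj)
  then show ?thesis
    using r g apart_image[OF g] G_comp G_inv by (auto simp: realised_def)
qed

lemma realised_trans:
  assumes "realised d e f" "realised a b c"
  shows "realised (T d e f a) (T d e f b) (T d e f c)"
  using assms realised_image unfolding realised_def by blast

lemma realised_apart:
  assumes "realised a b c"
  shows "apart a b" "apart b c" "apart a c"
  using assms by (auto simp: realised_def)

text \<open>Conjugation by the cycle \<open>T a d e\<close> sends \<open>a\<close> to
  \<open>d\<close> and leaves \<open>b\<close> and \<open>c\<close> alone.\<close>

lemma realised_replace:
  assumes "realised a b c" "realised a d e" "apart d b" "apart d c" "apart e b" "apart e c"
  shows "realised d b c"
  using realised_trans[OF assms(2,1)] T_apply[of a d e] realised_apart[OF assms(1)]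
    realised_apart[OF assms(2)] assms(3-6) apart_sym by metis

text \<open>The classical commutator trick: if the supports of two moves meet in one cubie only, their
  commutator is a three-cycle.\<close>

lemma realised_commutator:
  assumes f: "f \<in> G" and g: "g \<in> G"
    and apart: "apart a (f a)" "apart a (g a)" "apart (f a) (g a)"
    and meet: "\<And>x. f x \<noteq> x \<Longrightarrow> g x \<noteq> x \<Longrightarrow> x \<in> {a, opp a}"
  shows "realised a (f a) (g a)"
proof -
  have a: "a \<in> V"
    using apart by (simp add: apart_def)
  note bij = G_bij[OF f] G_bij[OF g]
  have inv_iff: "inv' f x = y \<longleftrightarrow> x = f y" "inv' g x = y \<longleftrightarrow> x = g y" for x y
    using bij bij_inv_eq_iff by metis+
  have opp: "f (opp a) = opp (f a)" "g (opp a) = opp (g a)"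
    using G_opp f g a by auto
  have inv_app: "inv' f (f a) = a" "inv' f (opp (f a)) = opp a"
    by (simp_all add: inv_iff opp)
  \<comment> \<open>The general formula with \<open>D\<close> equal to both facelets of the common
    cubie gives the order \<open>a\<close>, \<open>f a\<close>, \<open>g a\<close>.\<close>
  have "(f \<circ> g \<circ> inv' f \<circ> inv' g) x = T a (f a) (g a) x" for x
    using apartD[OF apart(1)] apartD[OF apart(2)] apartD[OF apart(3)] a
    by (subst commutator_apply[where D = "{a, opp a}", OF bij meet])
       (auto simp: paired_cycle_def transpose_def inv_iff opp inv_app)
  then have "f \<circ> g \<circ> inv' f \<circ> inv' g = T a (f a) (g a)"
    by (rule ext)
  then have "T a (f a) (g a) \<in> G"
    using f g G_comp G_inv by metis
  then show ?thesis
    using apart by (simp add: realised_def)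
qed

text \<open>Starting from the cycles through the fixed pair \<open>p\<close>, \<open>q\<close>,
  conjugation first removes one of the two, then the other, and finally flips \<open>p\<close> or
  \<open>q\<close> independently of the remaining entries. The bound \<open>room\<close> guarantees
  auxiliary cubies for these conjugations.\<close>

lemma realised_all:
  assumes base: "\<And>c. apart c p \<Longrightarrow> apart c q \<Longrightarrow> realised p q c"
    and pq: "apart p q" and fin: "finite V" and room: "card V > 8"
    and abc: "apart a b" "apart b c" "apart a c"
  shows "realised a b c"
proof -
  define away where "away x \<longleftrightarrow> apart x p \<and> apart x q" for x
  have away_opp: "away (opp x)" if "away x" for x
    using that apart_opp by (auto simp: away_def)
  \<comment> \<open>The excluded facelets make up at most four cubies, hence at most eight
    points.\<close>
  have fresh: "\<exists>e. away e \<and> apart e x \<and> apart e y" if "x \<in> V" "y \<in> V" for x y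
  proof -
    let ?W = "{p, opp p, q, opp q, x, opp x, y, opp y}"
    have "card ?W \<le> 8"
      using card_length[of "[p, opp p, q, opp q, x, opp x, y, opp y]"] by simp
    then have "\<not> V \<subseteq> ?W"
      using room card_mono[of ?W V] by auto
    then obtain e where "e \<in> V" "e \<notin> ?W"
      by blast
    then show ?thesis
      using that apartD[OF pq] unfolding away_def apart_def
      by (intro exI[of _ e]) (auto simp: opp_opp dest: arg_cong[of _ _ opp])
  qed
  have A1: "realised p q c" if "away c" for c
    using that base by (simp add: away_def)
  \<comment> \<open>Conjugating the cycle \<open>p q c\<close> by the cycle \<open>p q d\<close>
    gives \<open>q d c\<close>; conjugating it by the reversed cycle \<open>d q p\<close> gives
    \<open>d p c\<close>.\<close>
  have merge: "realised q d c \<and> realised p d c" if "away c" "away d" "apart c d" for c d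
  proof
    have c: "T p q d c = c" "T d q p c = c"
      using that apart_sym pq by (auto simp: away_def intro!: T_apply)
    show "realised q d c"
      using realised_trans[OF A1[OF that(2)] A1[OF that(1)]] T_apply[of p q d] c
        realised_apart[OF A1[OF that(2)]] by simp
    have "realised d p c"
      using realised_trans[OF realised_reverse[OF A1[OF that(2)]] A1[OF that(1)]] T_apply[of d q p] c
        realised_apart[OF realised_reverse[OF A1[OF that(2)]]] by simp
    then show "realised p d c"
      using realised_reverse realised_rotate by blast
  qed
  \<comment> \<open>The opposites of \<open>p\<close> and \<open>q\<close> come from reversing all
    three facelets at once, starting with the opposites of \<open>c\<close> and
    \<open>d\<close>.\<close>
  have A2: "realised x c d"
    if "x \<in> {p, opp p, q, opp q}" "away c" "away d" "apart c d" for x c d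
  proof -
    have "realised (opp p) (opp (opp c)) (opp (opp d))" "realised (opp q) (opp (opp c)) (opp (opp d))"
      using merge[of "opp d" "opp c"] that away_opp apart_opp apart_sym realised_opp by metis+
    then show ?thesis
      using merge[of d c] that apart_sym apartD[OF that(4)] by auto
  qed
  have A3: "realised c d e" if "away c" "away d" "away e" "apart c d" "apart d e" "apart c e" for c d e
  proof (rule realised_replace)
    show "realised p d e"
      using A2 that by auto
    show "realised p c q"
      using realised_reverse[OF realised_rotate[OF A1[OF that(1)]]] realised_rotate
      by blast
  qed (use that apart_sym in \<open>auto simp: away_def\<close>)
  \<comment> \<open>This flips \<open>p\<close> against \<open>q\<close> and \<open>c\<close>. In
    the cycle \<open>e q c\<close> the auxiliary facelet \<open>e\<close> is replaced by
    \<open>opp p\<close>, using the cycle \<open>e (opp p) f\<close>.\<close>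
  have B: "realised (opp p) q c" if "away c" for c
  proof -
    have "c \<in> V"
      using that by (simp add: away_def apart_def)
    then obtain e where e: "away e" "apart e c"
      using fresh by blast
    then obtain f where f: "away f" "apart f c" "apart f e"
      using fresh[of c e] \<open>c \<in> V\<close> apartD[OF e(2)] by blast
    show ?thesis
    proof (rule realised_replace)
      show "realised e q c"
        using A2[of q c e] e that realised_rotate apart_sym by blast
      show "realised e (opp p) f"
        using A2[of "opp p" f e] e f realised_rotate by blast
    qed (use that e f pq apart_opp apart_sym in \<open>auto simp: away_def\<close>)
  qed
  \<comment> \<open>The choices with \<open>opp q\<close> follow by reversing all three facelets in
    \<open>A1\<close> and \<open>B\<close>, applied to \<open>opp c\<close>.\<close>
  have C: "realised x y c" if "x \<in> {p, opp p}" "y \<in> {q, opp q}" "away c" for x y c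
  proof -
    have "realised (opp p) (opp q) (opp (opp c))" "realised (opp (opp p)) (opp q) (opp (opp c))"
      using A1 B away_opp that realised_opp by metis+
    moreover have "opp (opp c) = c" "opp (opp p) = p"
      using that pq by (auto simp: away_def apart_def)
    ultimately show ?thesis
      using A1 B that by auto
  qed
  have split: "away x \<or> x \<in> {p, opp p} \<or> x \<in> {q, opp q}" if "x \<in> V" for x
    using that apartD[OF pq] by (auto simp: away_def apart_def dest: arg_cong[of _ _ opp])
  have clash: "\<not> apart x y" if "x \<in> {z, opp z}" "y \<in> {z, opp z}" "z \<in> V" for x y z
    using that by (auto simp: apart_def)
  have V: "a \<in> V" "b \<in> V" "c \<in> V" "p \<in> V" "q \<in> V"
    using abc pq by (auto simp: apart_def)
  \<comment> \<open>At most two of the three cubies can be those of \<open>p\<close> and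
    \<open>q\<close>. The cases are settled by how many are, up to rotation and reversal of the
    cycle, which the last line undoes.\<close>
  have two: "realised a b c \<or> realised b c a \<or> realised c a b" if "\<not> (away a \<and> away b \<and> away c)"
    "\<not> (\<not> away a \<and> \<not> away b)" "\<not> (\<not> away b \<and> \<not> away c)" "\<not> (\<not> away a \<and> \<not> away c)"
    using that split[OF V(1)] split[OF V(2)] split[OF V(3)] A2 abc apart_sym by blast
  have one: "realised a b c \<or> realised b a c" if "\<not> away a" "\<not> away b"
    using that split[OF V(1)] split[OF V(2)] split[OF V(3)] C abc clash V by blast
  have one': "realised b c a \<or> realised c b a" if "\<not> away b" "\<not> away c"
    using that split[OF V(1)] split[OF V(2)] split[OF V(3)] C abc clash V by blast
  have one'': "realised a c b \<or> realised c a b" if "\<not> away a" "\<not> away c"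
    using that split[OF V(1)] split[OF V(2)] split[OF V(3)] C abc clash V by blast
  show ?thesis
    using A3 abc one one' one'' two realised_rotate realised_reverse by blast
qed

end

section \<open>The facelets and the cube group\<close>

lemma cubie_coords_odd:
  assumes "odd n"
  shows "cubie_coords n = {c. even c \<and> \<bar>c\<bar> \<le> int n - 1}"
proof (intro Set.set_eqI iffI)
  fix c assume "c \<in> cubie_coords n"
  then show "c \<in> {c. even c \<and> \<bar>c\<bar> \<le> int n - 1}"
    using assms by (auto simp: cubie_coords_def)
next
  fix c assume "c \<in> {c. even c \<and> \<bar>c\<bar> \<le> int n - 1}"
  then have c: "even c" "\<bar>c\<bar> \<le> int n - 1"
    by auto
  define d where "d = (c + int n + 1) div 2"
  have d: "2 * d = c + int n + 1"
    unfolding d_def using assms c(1) by (intro dvd_mult_div_cancel) simp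
  then have "nat d \<in> {1..n}" "c = 2 * int (nat d) - int n - 1"
    using c(2) by auto
  then show "c \<in> cubie_coords n"
    unfolding cubie_coords_def by blast
qed

lemma finite_facelets: "finite (facelets n)"
proof -
  have "\<bar>c\<bar> \<le> int n" if "c \<in> cubie_coords n" for c
    using that by (auto simp: cubie_coords_def)
  then have "facelets n \<subseteq> {- int n..int n} \<times> {- int n..int n} \<times> {- int n..int n}"
    by (fastforce simp: facelets_def abs_le_iff)
  then show ?thesis
    by (rule finite_subset) auto
qed

lemma height_quarter_turn [simp]: "height s (quarter_turn s p) = height s p"
  by (cases s; cases p) auto

lemma quarter_turn_4 [simp]:
  "quarter_turn s (quarter_turn s (quarter_turn s (quarter_turn s p))) = p"
  by (cases s; cases p) auto

locale odd_cube =
  fixes n :: nat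
  assumes n3: "n \<ge> 3" and odd_n: "odd n"
begin

abbreviation N :: int where "N \<equiv> int n"

lemma facelets_iff:
  "(x, y, z) \<in> facelets n \<longleftrightarrow>
     \<bar>x\<bar> = N \<and> even y \<and> \<bar>y\<bar> \<le> N - 1 \<and> even z \<and> \<bar>z\<bar> \<le> N - 1 \<or>
     even x \<and> \<bar>x\<bar> \<le> N - 1 \<and> \<bar>y\<bar> = N \<and> even z \<and> \<bar>z\<bar> \<le> N - 1 \<or>
     even x \<and> \<bar>x\<bar> \<le> N - 1 \<and> even y \<and> \<bar>y\<bar> \<le> N - 1 \<and> \<bar>z\<bar> = N"
  by (simp add: facelets_def cubie_coords_odd[OF odd_n])

lemma quarter_turn_facelets [simp]: "quarter_turn s p \<in> facelets n \<longleftrightarrow> p \<in> facelets n"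
  by (cases s; cases p) (auto simp: facelets_iff)

lemma quarter_turn_slice [simp]:
  "quarter_turn s p \<in> slice_facelets n s k \<longleftrightarrow> p \<in> slice_facelets n s k"
  by (simp add: slice_facelets_def)

lemma move_4: "move n s k (move n s k (move n s k (move n s k p))) = p"
  by (simp add: move_def)

lemma move_permutes: "move n s k permutes facelets n"
proof (rule inj_imp_permutes[OF _ finite_facelets])
  show "inj_on (move n s k) (facelets n)"
    by (metis inj_onI move_4)
qed (auto simp: move_def slice_facelets_def)

lemma inv_move: "inv' (move n s k) = move n s k \<circ> move n s k \<circ> move n s k"
  by (rule inv_unique_comp) (simp_all add: fun_eq_iff move_4)

abbreviation G :: "(point \<Rightarrow> point) set" where
  "G \<equiv> carrier (cube_group n)"

lemma carrier_cube_group: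
  "G = generate (sym_group_on (facelets n)) {move n s k | s k. 1 \<le> k \<and> k \<le> n div 2}"
  by (simp add: cube_group_def)

lemma cube_group_simps [simp]:
  "mult (cube_group n) = (\<circ>)" "one (cube_group n) = id"
  by (simp_all add: cube_group_def sym_group_on_def)

lemma moves_subset:
  "{move n s k | s k. 1 \<le> k \<and> k \<le> n div 2} \<subseteq> carrier (sym_group_on (facelets n))"
  using move_permutes by (auto simp: sym_group_on_def)

lemma subgroup_cube_group: "subgroup G (sym_group_on (facelets n))"
  unfolding carrier_cube_group
  by (rule group.generate_is_subgroup[OF group_sym_group_on moves_subset])

lemma group_cube_group: "group (cube_group n)"
  using group.subgroup_imp_group[OF group_sym_group_on subgroup_cube_group]
  by (simp add: cube_group_def)

lemma G_permutes: "g \<in> G \<Longrightarrow> g permutes facelets n"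
  using subgroup.subset[OF subgroup_cube_group] by (auto simp: sym_group_on_def)

lemma G_id: "id \<in> G"
  using group.is_monoid[OF group_cube_group, THEN monoid.one_closed] by simp

lemma G_move: "1 \<le> k \<Longrightarrow> k \<le> n div 2 \<Longrightarrow> move n s k \<in> G"
  unfolding carrier_cube_group by (auto intro: generate.incl)

lemma G_outer: "move n s (Suc 0) \<in> G"
  using n3 by (intro G_move) auto

lemma G_comp: "g \<in> G \<Longrightarrow> h \<in> G \<Longrightarrow> g \<circ> h \<in> G"
  using group.is_monoid[OF group_cube_group, THEN monoid.m_closed] by simp

lemma G_inv: "g \<in> G \<Longrightarrow> inv' g \<in> G"
  using subgroup.m_inv_closed[OF subgroup_cube_group] inv_sym_group_on[OF G_permutes] by metis

lemma inv_cube_group: "g \<in> G \<Longrightarrow> inv\<^bsub>cube_group n\<^esub> g = inv' g"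
  using permutes_inv_o(2)[OF G_permutes]
  by (intro group.inv_equality[OF group_cube_group]) (simp_all add: G_inv)

text \<open>The fourth power of a move is the identity, so its inverse is a product of three moves
  and is covered by the cases \<open>move\<close> and \<open>comp\<close>.\<close>

lemma G_induct [consumes 1, case_names id move comp]:
  assumes "g \<in> G" and id: "P id"
    and move: "\<And>s k. 1 \<le> k \<Longrightarrow> k \<le> n div 2 \<Longrightarrow> P (move n s k)"
    and comp: "\<And>g h. g \<in> G \<Longrightarrow> h \<in> G \<Longrightarrow> P g \<Longrightarrow> P h \<Longrightarrow> P (g \<circ> h)"
  shows "P g"
  using assms(1) unfolding carrier_cube_group
proof induction
  case one
  then show ?case
    using id by (simp add: sym_group_on_def id_def)
next
  case (incl h)
  then show ?case
    using move by auto
next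
  case (inv h)
  then obtain s k where h: "h = move n s k" "1 \<le> k" "k \<le> n div 2"
    by auto
  then have "inv\<^bsub>sym_group_on (facelets n)\<^esub> h = move n s k \<circ> move n s k \<circ> move n s k"
    using inv_sym_group_on[OF move_permutes] inv_move by simp
  then show ?case
    using comp[OF G_comp[OF G_move G_move] G_move comp[OF G_move G_move move move] move] h by (simp add: o_def)
next
  case (eng g h)
  then show ?case
    using comp by (simp add: carrier_cube_group sym_group_on_def o_def)
qed

section \<open>Cubies\<close>

text \<open>Among facelet coordinates only \<open>N\<close> and \<open>- N\<close> change, each by
  one unit inwards. Thus \<open>cubie_of\<close> sends a facelet to the centre of the cubie that
  carries it.\<close>

definition clamp :: "int \<Rightarrow> int" where
  "clamp c = max (1 - N) (min (N - 1) c)"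

fun cubie_of :: "point \<Rightarrow> point" where
  "cubie_of (x, y, z) = (clamp x, clamp y, clamp z)"

lemma clamp_simps:
  "\<bar>c\<bar> \<le> N - 1 \<Longrightarrow> clamp c = c" "clamp (- c) = - clamp c"
  using n3 by (auto simp: clamp_def max_def min_def)

text \<open>A facelet has exactly one coordinate of absolute value \<open>N\<close>, and this
  differs from every cubie coordinate by at least 1. Total distance 1 therefore forces the other two
  coordinates to agree.\<close>

lemma cubie_facelets_eq:
  assumes "a \<in> cubie_coords n" "b \<in> cubie_coords n" "c \<in> cubie_coords n"
  shows "cubie_facelets n (a, b, c) = {p \<in> facelets n. cubie_of p = (a, b, c)}"
proof (intro Set.set_eqI)
  fix p :: point
  obtain x y z where p: "p = (x, y, z)"
    by (cases p)
  have outer: "1 \<le> \<bar>h - d\<bar>" "clamp h = d \<longleftrightarrow> \<bar>h - d\<bar> = 1" if "\<bar>h\<bar> = N" "\<bar>d\<bar> \<le> N - 1" for h d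
    using that n3 by (auto simp: clamp_def abs_if split: if_splits)
  have abc: "\<bar>a\<bar> \<le> N - 1" "\<bar>b\<bar> \<le> N - 1" "\<bar>c\<bar> \<le> N - 1"
    using assms by (auto simp: cubie_coords_odd[OF odd_n])
  have sum1: "1 \<le> u \<Longrightarrow> 0 \<le> v \<Longrightarrow> 0 \<le> w \<Longrightarrow> u + v + w = 1 \<longleftrightarrow> u = 1 \<and> v = 0 \<and> w = 0" for u v w :: int
    by auto
  have "\<bar>x - a\<bar> + \<bar>y - b\<bar> + \<bar>z - c\<bar> = 1 \<longleftrightarrow> clamp x = a \<and> clamp y = b \<and> clamp z = c"
    if pF: "p \<in> facelets n"
  proof -
    consider "\<bar>x\<bar> = N" "\<bar>y\<bar> \<le> N - 1" "\<bar>z\<bar> \<le> N - 1" | "\<bar>y\<bar> = N" "\<bar>x\<bar> \<le> N - 1" "\<bar>z\<bar> \<le> N - 1"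
      | "\<bar>z\<bar> = N" "\<bar>x\<bar> \<le> N - 1" "\<bar>y\<bar> \<le> N - 1"
      using pF by (auto simp: p facelets_iff)
    then show ?thesis
    proof cases
      case 1
      then show ?thesis
        using outer[OF 1(1) abc(1)] sum1[of "\<bar>x - a\<bar>" "\<bar>y - b\<bar>" "\<bar>z - c\<bar>"] by (auto simp: clamp_simps(1) add_ac)
    next
      case 2
      then show ?thesis
        using outer[OF 2(1) abc(2)] sum1[of "\<bar>y - b\<bar>" "\<bar>x - a\<bar>" "\<bar>z - c\<bar>"] by (auto simp: clamp_simps(1) add_ac)
    next
      case 3
      then show ?thesis
        using outer[OF 3(1) abc(3)] sum1[of "\<bar>z - c\<bar>" "\<bar>x - a\<bar>" "\<bar>y - b\<bar>"] by (auto simp: clamp_simps(1) add_ac)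
    qed
  qed
  then show "p \<in> cubie_facelets n (a, b, c) \<longleftrightarrow> p \<in> {p \<in> facelets n. cubie_of p = (a, b, c)}"
    by (auto simp: cubie_facelets_def p)
qed

lemma cubie_of_quarter_turn: "cubie_of (quarter_turn s p) = quarter_turn s (cubie_of p)"
  by (cases s; cases p) (auto simp: clamp_simps)

text \<open>Membership in a slice depends only on the cubie, so a move carries whole cubies to whole
  cubies.\<close>

lemma slice_iff:
  assumes "p \<in> facelets n" "1 \<le> k" "k \<le> n div 2"
  shows "p \<in> slice_facelets n s k \<longleftrightarrow> height s (cubie_of p) = N - 2 * int k + 1"
proof -
  obtain x y z where p: "p = (x, y, z)"
    by (cases p)
  have k: "2 * int k \<le> N - 1" "int k \<ge> 1"
    using assms(2,3) odd_n by (auto elim!: oddE)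
  have *: "N - 2 * int k \<le> h \<and> h \<le> N - 2 * int k + 2 \<longleftrightarrow> clamp h = N - 2 * int k + 1"
    if "\<bar>h\<bar> = N \<or> even h \<and> \<bar>h\<bar> \<le> N - 1" for h
    using that
  proof
    assume "\<bar>h\<bar> = N"
    then show ?thesis
      using k n3 by (auto simp: clamp_def)
  next
    assume h: "even h \<and> \<bar>h\<bar> \<le> N - 1"
    \<comment> \<open>The bounds of the slab are odd for odd \<open>n\<close>, so an even coordinate
      in the slab must be its midpoint.\<close>
    then have "h \<noteq> N - 2 * int k" "h \<noteq> N - 2 * int k + 2"
      using odd_n by auto
    then show ?thesis
      using h by (auto simp: clamp_def)
  qed
  have "\<bar>x\<bar> = N \<or> even x \<and> \<bar>x\<bar> \<le> N - 1" "\<bar>y\<bar> = N \<or> even y \<and> \<bar>y\<bar> \<le> N - 1"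
    "\<bar>z\<bar> = N \<or> even z \<and> \<bar>z\<bar> \<le> N - 1"
    using assms(1) by (auto simp: p facelets_iff)
  then show ?thesis
    using assms(1) *[of x] *[of y] *[of z] *[of "- x"] *[of "- y"] *[of "- z"]
    by (cases s) (auto simp: slice_facelets_def p clamp_simps)
qed

section \<open>The effect of moves on cubie centres, edges and corners\<close>

definition turn_cubie :: "face \<Rightarrow> nat \<Rightarrow> point \<Rightarrow> point" where
  "turn_cubie s k c = (if height s c = N - 2 * int k + 1 then quarter_turn s c else c)"

lemma cubie_of_move:
  assumes "p \<in> facelets n" "1 \<le> k" "k \<le> n div 2"
  shows "cubie_of (move n s k p) = turn_cubie s k (cubie_of p)"
  using slice_iff[OF assms] by (simp add: move_def turn_cubie_def cubie_of_quarter_turn)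

lemma turn_cubie_inj: "turn_cubie s k c = turn_cubie s k d \<Longrightarrow> c = d"
proof -
  have "turn_cubie s k (turn_cubie s k (turn_cubie s k (turn_cubie s k c))) = c" for c
    by (simp add: turn_cubie_def)
  then show "turn_cubie s k c = turn_cubie s k d \<Longrightarrow> c = d"
    by metis
qed

text \<open>The edge and corner cubies in question have centres \<open>(n - 1) t\<close> with \<open>t \<in> {-1, 0, 1}\<^sup>3\<close>.\<close>

definition edge_dirs :: "point set" where
  "edge_dirs = {0} \<times> {-1, 1} \<times> {-1, 1} \<union> {-1, 1} \<times> {0} \<times> {-1, 1} \<union> {-1, 1} \<times> {-1, 1} \<times> {0}"

definition corner_dirs :: "point set" where
  "corner_dirs = {-1, 1} \<times> {-1, 1} \<times> {-1, 1}"

fun scale :: "point \<Rightarrow> point" where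
  "scale (i, j, k) = ((N - 1) * i, (N - 1) * j, (N - 1) * k)"

definition block :: "point \<Rightarrow> point set" where
  "block t = cubie_facelets n (scale t)"

definition turn_dir :: "face \<Rightarrow> point \<Rightarrow> point" where
  "turn_dir s t = (if height s t = 1 then quarter_turn s t else t)"

lemma block_eq:
  assumes "t \<in> edge_dirs \<union> corner_dirs"
  shows "block t = {p \<in> facelets n. cubie_of p = scale t}"
proof -
  obtain i j k where t: "t = (i, j, k)"
    by (cases t)
  have *: "(N - 1) * c \<in> cubie_coords n" if "\<bar>c\<bar> \<le> 1" for c
  proof -
    have "c = -1 \<or> c = 0 \<or> c = 1"
      using that by auto
    then show ?thesis
      using odd_n n3 by (auto simp: cubie_coords_odd[OF odd_n])
  qed
  have "\<bar>i\<bar> \<le> 1" "\<bar>j\<bar> \<le> 1" "\<bar>k\<bar> \<le> 1"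
    using assms by (auto simp: t edge_dirs_def corner_dirs_def)
  then show ?thesis
    unfolding block_def t scale.simps by (intro cubie_facelets_eq *)
qed

lemma turn_dir_in:
  "t \<in> edge_dirs \<Longrightarrow> turn_dir s t \<in> edge_dirs"
  "t \<in> corner_dirs \<Longrightarrow> turn_dir s t \<in> corner_dirs"
  by (cases s; cases t; auto simp: turn_dir_def edge_dirs_def corner_dirs_def)+

text \<open>Single edges and corners have heights \<open>1 - N\<close>, \<open>0\<close> or
  \<open>N - 1\<close>. The \<open>k\<close>-th slice has height \<open>N - 2 * int k + 1\<close>,
  which is at least 2 and equals \<open>N - 1\<close> only for \<open>k = 1\<close>, so inner slices
  contain none of them.\<close>

lemma turn_cubie_scale:
  assumes t: "t \<in> edge_dirs \<union> corner_dirs" and k: "1 \<le> k" "k \<le> n div 2"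
  shows "turn_cubie s k (scale t) = scale (if k = 1 then turn_dir s t else t)"
proof -
  have height: "height s (scale t) = (N - 1) * height s t"
    by (cases s; cases t) auto
  have turn: "quarter_turn s (scale t) = scale (quarter_turn s t)"
    by (cases s; cases t) auto
  have "height s t \<in> {-1, 0, 1}"
    using t by (cases s; cases t) (auto simp: edge_dirs_def corner_dirs_def)
  then have "(N - 1) * height s t = N - 2 * int k + 1 \<longleftrightarrow> k = 1 \<and> height s t = 1"
    using k n3 odd_n by (auto elim!: oddE)
  then show ?thesis
    unfolding turn_cubie_def turn_dir_def height turn by auto
qed

text \<open>Blocks are fibres of \<open>cubie_of\<close>, which intertwines a move with the
  injective map \<open>turn_cubie\<close>; hence fibres go onto fibres.\<close>

lemma move_block:
  assumes t: "t \<in> edge_dirs \<union> corner_dirs" and k: "1 \<le> k" "k \<le> n div 2"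
  shows "move n s k ` block t = block (if k = 1 then turn_dir s t else t)"
proof -
  let ?t = "if k = 1 then turn_dir s t else t"
  have t': "?t \<in> edge_dirs \<union> corner_dirs"
    using t turn_dir_in[of t s] by auto
  show ?thesis
    unfolding block_eq[OF t] block_eq[OF t'] turn_cubie_scale[OF t k, symmetric]
  proof (intro subset_antisym subsetI)
    fix q assume q: "q \<in> {p \<in> facelets n. cubie_of p = turn_cubie s k (scale t)}"
    then have "q \<in> move n s k ` facelets n"
      using permutes_image[OF move_permutes] by auto
    then obtain p where p: "q = move n s k p" "p \<in> facelets n"
      by auto
    have "cubie_of p = scale t"
      by (rule turn_cubie_inj[of s k]) (use q p cubie_of_move[OF p(2) k, of s] in simp)
    then show "q \<in> move n s k ` {p \<in> facelets n. cubie_of p = scale t}"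
      using p by blast
  next
    fix q assume "q \<in> move n s k ` {p \<in> facelets n. cubie_of p = scale t}"
    then obtain p where p: "q = move n s k p" "p \<in> facelets n" "cubie_of p = scale t"
      by blast
    then show "q \<in> {p \<in> facelets n. cubie_of p = turn_cubie s k (scale t)}"
      using cubie_of_move[OF p(2) k, of s] permutes_in_image[OF move_permutes] by simp
  qed
qed


section \<open>Single edges\<close>

lemma single_edges_eq: "single_edges n = block ` edge_dirs"
proof -
  have "{(x, y, z).
     x = 0 \<and> \<bar>y\<bar> = N - 1 \<and> \<bar>z\<bar> = N - 1 \<or>
     \<bar>x\<bar> = N - 1 \<and> y = 0 \<and> \<bar>z\<bar> = N - 1 \<or>
     \<bar>x\<bar> = N - 1 \<and> \<bar>y\<bar> = N - 1 \<and> z = 0} = scale ` edge_dirs" (is "?L = _")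
  proof (intro equalityI subsetI)
    fix p assume "p \<in> ?L"
    moreover obtain x y z where p: "p = (x, y, z)"
      by (cases p)
    ultimately have "p = scale (sgn x, sgn y, sgn z)" "(sgn x, sgn y, sgn z) \<in> edge_dirs"
      using n3 by (auto simp: edge_dirs_def sgn_if)
    then show "p \<in> scale ` edge_dirs"
      by blast
  next
    fix p assume "p \<in> scale ` edge_dirs"
    then obtain i j k where p: "p = scale (i, j, k)" "(i, j, k) \<in> edge_dirs"
      by (metis imageE prod_cases3)
    then have "i = 0 \<and> \<bar>j\<bar> = 1 \<and> \<bar>k\<bar> = 1 \<or> \<bar>i\<bar> = 1 \<and> j = 0 \<and> \<bar>k\<bar> = 1 \<or> \<bar>i\<bar> = 1 \<and> \<bar>j\<bar> = 1 \<and> k = 0"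
      by (auto simp: edge_dirs_def)
    then show "p \<in> ?L"
      using n3 p by (auto simp: abs_mult)
  qed
  then show ?thesis
    unfolding single_edges_def by (simp add: block_def image_image)
qed

definition V :: "point set" where
  "V = \<Union> (single_edges n)"

text \<open>The coordinates \<open>n\<close> and \<open>n - 1\<close> are interchanged, preserving signs.\<close>

definition swap_outer :: "int \<Rightarrow> int" where
  "swap_outer c = sgn c * (2 * N - 1 - \<bar>c\<bar>)"

fun opp :: "point \<Rightarrow> point" where
  "opp (x, y, z) = (swap_outer x, swap_outer y, swap_outer z)"

lemma swap_outer_simps [simp]:
  "swap_outer 0 = 0"
  "\<bar>c\<bar> = N \<Longrightarrow> \<bar>swap_outer c\<bar> = N - 1"
  "\<bar>c\<bar> = N - 1 \<Longrightarrow> \<bar>swap_outer c\<bar> = N"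
  using n3 by (auto simp: swap_outer_def abs_mult abs_sgn_eq)

lemma sgn_swap_outer:
  "\<bar>c\<bar> \<le> N \<Longrightarrow> sgn (swap_outer c) = sgn c"
  using n3 by (simp add: swap_outer_def sgn_mult)

lemma eq_of_sgn_abs: "sgn c = sgn d \<Longrightarrow> \<bar>c\<bar> = \<bar>d\<bar> \<Longrightarrow> c = d" for c d :: int
  by (metis mult_sgn_abs)

lemma eq_swap_outer: "sgn c = sgn d \<Longrightarrow> \<bar>c\<bar> + \<bar>d\<bar> = 2 * N - 1 \<Longrightarrow> c = swap_outer d"
  by (metis add_diff_cancel_right' mult_sgn_abs swap_outer_def)

lemma swap_outer_swap_outer:
  assumes "\<bar>c\<bar> \<le> N"
  shows "swap_outer (swap_outer c) = c"
proof (cases "c = 0")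
  case False
  then have "\<bar>c\<bar> + \<bar>swap_outer c\<bar> = 2 * N - 1"
    using assms n3 by (simp add: swap_outer_def abs_mult abs_sgn_eq)
  then show ?thesis
    using eq_swap_outer[of c "swap_outer c"] sgn_swap_outer[OF assms] by simp
qed simp

text \<open>The signs of the coordinates determine the edge, and the order in which \<open>N\<close>
  and \<open>N - 1\<close> occur as absolute values determines the facelet on it.\<close>

lemma mem_block_edge:
  assumes "t \<in> edge_dirs"
  shows "(x, y, z) \<in> block t \<longleftrightarrow> t = (sgn x, sgn y, sgn z) \<and>
    (x = 0 \<and> (\<bar>y\<bar> = N \<and> \<bar>z\<bar> = N - 1 \<or> \<bar>y\<bar> = N - 1 \<and> \<bar>z\<bar> = N) \<or>
     y = 0 \<and> (\<bar>x\<bar> = N \<and> \<bar>z\<bar> = N - 1 \<or> \<bar>x\<bar> = N - 1 \<and> \<bar>z\<bar> = N) \<or>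
     z = 0 \<and> (\<bar>x\<bar> = N \<and> \<bar>y\<bar> = N - 1 \<or> \<bar>x\<bar> = N - 1 \<and> \<bar>y\<bar> = N))"
proof -
  obtain i j k where t: "t = (i, j, k)"
    by (cases t)
  have coord: "clamp c = (N - 1) * l \<longleftrightarrow> (if l = 0 then c = 0 else N - 1 \<le> \<bar>c\<bar> \<and> l = sgn c)"
    if "\<bar>l\<bar> \<le> 1" for c l
  proof -
    have "l = -1 \<or> l = 0 \<or> l = 1"
      using that by auto
    then show ?thesis
      using n3 by (elim disjE) (auto simp: clamp_def sgn_if)
  qed
  have ev: "even c" if "\<bar>c\<bar> = N - 1" for c
  proof -
    have "even \<bar>c\<bar>"
      unfolding that using odd_n by simp
    then show ?thesis by simp
  qed
  have outer: "(\<bar>c\<bar> = N \<and> even d \<and> \<bar>d\<bar> \<le> N - 1 \<or> even c \<and> \<bar>c\<bar> \<le> N - 1 \<and> \<bar>d\<bar> = N) \<and>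
      N - 1 \<le> \<bar>c\<bar> \<and> N - 1 \<le> \<bar>d\<bar> \<longleftrightarrow> \<bar>c\<bar> = N \<and> \<bar>d\<bar> = N - 1 \<or> \<bar>c\<bar> = N - 1 \<and> \<bar>d\<bar> = N" for c d
    using ev[of c] ev[of d] by auto
  have le: "\<bar>i\<bar> \<le> 1" "\<bar>j\<bar> \<le> 1" "\<bar>k\<bar> \<le> 1"
    using assms by (auto simp: t edge_dirs_def)
  have iff: "(x, y, z) \<in> block t \<longleftrightarrow> (x, y, z) \<in> facelets n \<and>
      (if i = 0 then x = 0 else N - 1 \<le> \<bar>x\<bar> \<and> i = sgn x) \<and>
      (if j = 0 then y = 0 else N - 1 \<le> \<bar>y\<bar> \<and> j = sgn y) \<and>
      (if k = 0 then z = 0 else N - 1 \<le> \<bar>z\<bar> \<and> k = sgn z)"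
    unfolding block_eq[OF UnI1[OF assms]] unfolding t mem_Collect_eq cubie_of.simps scale.simps
    by (simp only: prod.inject coord[OF le(1)] coord[OF le(2)] coord[OF le(3)])
  consider "i = 0" "j \<noteq> 0" "k \<noteq> 0" | "i \<noteq> 0" "j = 0" "k \<noteq> 0" | "i \<noteq> 0" "j \<noteq> 0" "k = 0"
    using assms by (auto simp: t edge_dirs_def)
  then show ?thesis
  proof cases
    case 1
    then show ?thesis
      unfolding iff unfolding t facelets_iff using outer[of y z] n3
      by (cases "x = 0"; cases "y = 0"; cases "z = 0"; simp; blast)
  next
    case 2
    then show ?thesis
      unfolding iff unfolding t facelets_iff using outer[of x z] n3
      by (cases "x = 0"; cases "y = 0"; cases "z = 0"; simp; blast)
  next
    case 3
    then show ?thesis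
      unfolding iff unfolding t facelets_iff using outer[of x y] n3
      by (cases "x = 0"; cases "y = 0"; cases "z = 0"; simp; blast)
  qed
qed

lemma V_iff:
  "(x, y, z) \<in> V \<longleftrightarrow>
     x = 0 \<and> (\<bar>y\<bar> = N \<and> \<bar>z\<bar> = N - 1 \<or> \<bar>y\<bar> = N - 1 \<and> \<bar>z\<bar> = N) \<or>
     y = 0 \<and> (\<bar>x\<bar> = N \<and> \<bar>z\<bar> = N - 1 \<or> \<bar>x\<bar> = N - 1 \<and> \<bar>z\<bar> = N) \<or>
     z = 0 \<and> (\<bar>x\<bar> = N \<and> \<bar>y\<bar> = N - 1 \<or> \<bar>x\<bar> = N - 1 \<and> \<bar>y\<bar> = N)" (is "_ \<longleftrightarrow> ?R")
proof
  assume "(x, y, z) \<in> V"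
  then show ?R
    unfolding V_def single_edges_eq using mem_block_edge by auto
next
  assume R: ?R
  then have t: "(sgn x, sgn y, sgn z) \<in> edge_dirs"
    using n3 by (auto simp: edge_dirs_def sgn_if)
  then have "(x, y, z) \<in> block (sgn x, sgn y, sgn z)"
    using R mem_block_edge by simp
  then show "(x, y, z) \<in> V"
    unfolding V_def single_edges_eq using t by blast
qed

lemma V_facelets: "a \<in> V \<Longrightarrow> a \<in> facelets n"
  using block_eq by (auto simp: V_def single_edges_eq)

lemma opp_V:
  assumes "a \<in> V"
  shows "opp a \<in> V" "opp (opp a) = a" "opp a \<noteq> a"
proof -
  obtain x y z where a: "a = (x, y, z)"
    by (cases a)
  show "opp a \<in> V"
    using assms unfolding a opp.simps V_iff by (elim disjE conjE) simp_all
  have "\<bar>x\<bar> \<le> N" "\<bar>y\<bar> \<le> N" "\<bar>z\<bar> \<le> N"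
    using assms n3 by (auto simp: a V_iff)
  then show "opp (opp a) = a"
    by (simp add: a swap_outer_swap_outer)
  have "swap_outer c \<noteq> c" if "\<bar>c\<bar> = N \<or> \<bar>c\<bar> = N - 1" for c
  proof
    assume eq: "swap_outer c = c"
    show False
      using that swap_outer_simps(2,3)[of c] unfolding eq by auto
  qed
  then show "opp a \<noteq> a"
    using assms by (auto simp: a V_iff)
qed

text \<open>Two facelets of one single edge agree in all signs. Their nonzero coordinates have
  absolute values \<open>N\<close> and \<open>N - 1\<close> either in the same order, so that they
  coincide, or in the exchanged order, so that they are opposite.\<close>

lemma single_edge_eq:
  assumes e: "e \<in> single_edges n" and a: "a \<in> e"
  shows "e = {a, opp a}"
proof -
  obtain x y z where xyz: "a = (x, y, z)"
    by (cases a)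
  obtain t where t: "t \<in> edge_dirs" "e = block t"
    using e unfolding single_edges_eq by auto
  note mem = mem_block_edge[OF t(1)]
  have a': "t = (sgn x, sgn y, sgn z)" "a \<in> V"
    using a mem e unfolding t xyz V_def by auto
  have le: "\<bar>x\<bar> \<le> N" "\<bar>y\<bar> \<le> N" "\<bar>z\<bar> \<le> N"
    using a'(2) n3 by (auto simp: xyz V_iff)
  have "opp a \<in> e"
    using opp_V(1)[OF a'(2)] le unfolding t xyz opp.simps mem V_iff
    by (simp add: a'(1) sgn_swap_outer)
  moreover have "b = a \<or> b = opp a" if "b \<in> e" for b
  proof -
    obtain u v w where b: "b = (u, v, w)"
      by (cases b)
    have sgn: "sgn u = sgn x" "sgn v = sgn y" "sgn w = sgn z"
      using that mem a' unfolding t b by auto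
    then have "u = 0 \<longleftrightarrow> x = 0" "v = 0 \<longleftrightarrow> y = 0" "w = 0 \<longleftrightarrow> z = 0"
      by (metis sgn_0_0)+
    moreover have "b \<in> V"
      using that e unfolding V_def by blast
    ultimately have "\<bar>u\<bar> = \<bar>x\<bar> \<and> \<bar>v\<bar> = \<bar>y\<bar> \<and> \<bar>w\<bar> = \<bar>z\<bar> \<or>
      (u = 0 \<and> x = 0 \<or> \<bar>u\<bar> + \<bar>x\<bar> = 2 * N - 1) \<and> (v = 0 \<and> y = 0 \<or> \<bar>v\<bar> + \<bar>y\<bar> = 2 * N - 1) \<and>
      (w = 0 \<and> z = 0 \<or> \<bar>w\<bar> + \<bar>z\<bar> = 2 * N - 1)"
      using a'(2) n3 unfolding b xyz V_iff by (elim disjE conjE) simp_all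
    then show ?thesis
    proof (elim disjE)
      assume "\<bar>u\<bar> = \<bar>x\<bar> \<and> \<bar>v\<bar> = \<bar>y\<bar> \<and> \<bar>w\<bar> = \<bar>z\<bar>"
      then show ?thesis
        using eq_of_sgn_abs[OF sgn(1)] eq_of_sgn_abs[OF sgn(2)] eq_of_sgn_abs[OF sgn(3)]
        by (simp add: b xyz)
    next
      assume "(u = 0 \<and> x = 0 \<or> \<bar>u\<bar> + \<bar>x\<bar> = 2 * N - 1) \<and> (v = 0 \<and> y = 0 \<or> \<bar>v\<bar> + \<bar>y\<bar> = 2 * N - 1) \<and>
        (w = 0 \<and> z = 0 \<or> \<bar>w\<bar> + \<bar>z\<bar> = 2 * N - 1)"
      then have "u = swap_outer x" "v = swap_outer y" "w = swap_outer z"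
        using eq_swap_outer[OF sgn(1)] eq_swap_outer[OF sgn(2)] eq_swap_outer[OF sgn(3)] by auto
      then show ?thesis
        by (simp add: b xyz)
    qed
  qed
  ultimately show ?thesis
    using a by blast
qed

lemma single_edge_disjoint:
  assumes "e \<in> single_edges n" "e' \<in> single_edges n" "a \<in> e" "a \<in> e'"
  shows "e = e'"
  using assms single_edge_eq by metis

lemma V_single_edge: "a \<in> V \<Longrightarrow> {a, opp a} \<in> single_edges n"
  using single_edge_eq[of _ a] unfolding V_def by auto

section \<open>The action of the cube group on single-edge facelets\<close>

lemma G_single_edges:
  assumes "g \<in> G" "e \<in> single_edges n"
  shows "g ` e \<in> single_edges n"
  using assms
proof (induction arbitrary: e rule: G_induct)
  case (move s k)
  then obtain t where "t \<in> edge_dirs" "e = block t"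
    by (auto simp: single_edges_eq)
  then show ?case
    using move_block[OF _ move(1,2), of t s] turn_dir_in(1)[of t s] by (auto simp: single_edges_eq)
next
  case (comp g h)
  then show ?case
    by (metis image_comp)
qed simp

text \<open>An element of \<open>G\<close> sends the facelet pair of a single edge to such a pair,
  and by injectivity the second facelet goes to the opposite of the image of the first.\<close>

sublocale paired_action V opp G
proof
  fix g a assume g: "g \<in> G" and a: "a \<in> V"
  have "g ` {a, opp a} \<in> single_edges n"
    using G_single_edges[OF g V_single_edge[OF a]] .
  then have *: "{g a, g (opp a)} \<in> single_edges n"
    by simp
  then show "g a \<in> V"
    unfolding V_def by blast
  have "g (opp a) \<noteq> g a"
    using permutes_inj[OF G_permutes[OF g]] opp_V[OF a] by (simp add: inj_eq)
  moreover have "{g a, g (opp a)} = {g a, opp (g a)}"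
    using single_edge_eq[OF *] by blast
  ultimately show "g (opp a) = opp (g a)"
    by (auto simp: doubleton_eq_iff)
qed (use opp_V G_comp G_inv permutes_bij[OF G_permutes] in auto)

section \<open>Three-cycles of single edges in the cube group\<close>

lemma move_outer:
  assumes "p \<in> facelets n"
  shows "move n s (Suc 0) p = (if N - 1 \<le> height s p then quarter_turn s p else p)"
proof -
  have "height s (cubie_of p) = clamp (height s p)"
    by (cases s; cases p) (auto simp: clamp_simps(2))
  moreover have "clamp h = N - 1 \<longleftrightarrow> N - 1 \<le> h" for h
    using n3 by (auto simp: clamp_def)
  ultimately show ?thesis
    using slice_iff[OF assms, of "Suc 0" s] n3 by (simp add: move_def)
qed

lemmas move_V = move_outer[OF V_facelets]

text \<open>Turning all the slices orthogonal to the \<open>x\<close>-axis except the middle one is, up to a rotation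
  of the whole cube, a turn of the middle slice.\<close>

definition around_middle :: "point \<Rightarrow> point" where
  "around_middle p = (if p \<in> facelets n \<and> fst p \<noteq> 0 then quarter_turn Right p else p)"

lemma G_around_middle: "around_middle \<in> G"
proof -
  \<comment> \<open>\<open>f j\<close> turns the \<open>j\<close> outermost slices on the right and
    on the left; \<open>N + 1 - 2 * int j\<close> is the distance of the innermost of them from the
    centre.\<close>
  define f where "f j p = (if p \<in> facelets n \<and> N + 1 - 2 * int j \<le> \<bar>fst p\<bar> then quarter_turn Right p else p)"
    for j p
  have fst_turn: "fst (quarter_turn Right p) = fst p" "fst (quarter_turn Left p) = fst p" for p
    by (cases p, simp)+
  have coord: "\<bar>fst p\<bar> = N \<or> even (fst p) \<and> \<bar>fst p\<bar> \<le> N - 1" if "p \<in> facelets n" for p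
    using that by (cases p) (auto simp: facelets_iff)
  have "f j \<in> G" if "j \<le> n div 2" for j
    using that
  proof (induction j)
    case 0
    have "f 0 = id"
      using coord by (fastforce simp: f_def)
    then show ?case
      using G_id by metis
  next
    case (Suc j)
    let ?R = "move n Right (Suc j)" and ?L = "move n Left (Suc j)"
    \<comment> \<open>Three clockwise quarter turns seen from the left amount to one clockwise
      quarter turn seen from the right.\<close>
    have "f (Suc j) p = (f j \<circ> (?R \<circ> (?L \<circ> ?L \<circ> ?L))) p" for p
    proof (cases "p \<in> facelets n")
      case True
      have j: "2 * int j + 3 \<le> N"
        using Suc(2) odd_n by (auto elim!: oddE)
      have c: "fst p \<noteq> N - 2 - 2 * int j" "fst p \<noteq> 2 * int j + 2 - N"
        "j \<noteq> 0 \<Longrightarrow> fst p \<noteq> N - 2 * int j" "j \<noteq> 0 \<Longrightarrow> fst p \<noteq> 2 * int j - N"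
        using coord[OF True] j odd_n by auto
      have h: "height Right p = fst p" "height Left p = - fst p"
        by (cases p, simp)+
      have t: "quarter_turn Left (quarter_turn Left (quarter_turn Left p)) = quarter_turn Right p"
        by (cases p) simp
      show ?thesis
        using True c coord[OF True] j
        by (auto simp: f_def move_def slice_facelets_def h t fst_turn)
    qed (simp add: f_def move_def slice_facelets_def)
    then have "f (Suc j) = f j \<circ> (?R \<circ> (?L \<circ> ?L \<circ> ?L))"
      by blast
    moreover have "?R \<in> G" "?L \<in> G"
      using Suc G_move by auto
    ultimately show ?case
      using Suc G_comp by (metis Suc_leD)
  qed
  from this[of "n div 2"] have "f (n div 2) \<in> G"
    by simp
  moreover have "f (n div 2) p = around_middle p" for p
  proof (cases "p \<in> facelets n")
    case True
    have "N + 1 - 2 * int (n div 2) \<le> \<bar>fst p\<bar> \<longleftrightarrow> 2 \<le> \<bar>fst p\<bar>"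
      using odd_n by (auto elim!: oddE)
    \<comment> \<open>The coordinate is even or has absolute value \<open>N\<close>, so absolute
      value 1 cannot occur.\<close>
    moreover have "2 \<le> \<bar>fst p\<bar> \<longleftrightarrow> fst p \<noteq> 0"
      using coord[OF True] n3 by (cases "\<bar>fst p\<bar> = 1") auto
    ultimately show ?thesis
      unfolding f_def around_middle_def by simp
  qed (simp add: f_def around_middle_def)
  then have "f (n div 2) = around_middle"
    by blast
  ultimately show ?thesis
    by simp
qed


text \<open>\<open>DF\<close>, \<open>DR\<close> and \<open>UL\<close> stand for the front, right and upper facelet of the respective edge.\<close>

abbreviation "DF \<equiv> (0, 1 - N, N)"
abbreviation "DR \<equiv> (N, 1 - N, 0)"
abbreviation "UL \<equiv> (1 - N, N, 0)"

lemma realised_DF_DR_UL: "realised DF DR UL"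
proof -
  let ?D = "move n Down (Suc 0)" and ?F = "move n Front (Suc 0)"
  define g where "g = around_middle \<circ> ?F \<circ> inv' around_middle"
  have G: "?D \<in> G" "g \<in> G"
    unfolding g_def using G_outer G_around_middle G_comp G_inv by auto
  have V: "DF \<in> V" "DR \<in> V" "UL \<in> V"
    using n3 by (auto simp: V_iff)
  have bij: "bij around_middle"
    using G_bij G_around_middle by blast
  have inv_DF: "inv' around_middle DF = DF"
    by (rule inv_f_eq) (use bij in \<open>simp_all add: bij_is_inj around_middle_def\<close>)
  have "(1 - N, 0, N) \<in> V"
    using n3 by (auto simp: V_iff)
  then have g: "g DF = UL"
    unfolding g_def using V n3 V_facelets by (auto simp: inv_DF move_V around_middle_def)
  have D: "?D DF = DR"
    using V n3 by (simp add: move_V)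
  have "x \<in> {DF, opp DF}" if Dx: "?D x \<noteq> x" and gx: "g x \<noteq> x" for x
  proof -
    define w where "w = inv' around_middle x"
    have x: "x = around_middle w"
      unfolding w_def using bij by (simp add: bij_is_surj surj_f_inv_f)
    have layer: "y \<in> facelets n \<and> N - 1 \<le> height s y" if "move n s (Suc 0) y \<noteq> y" for s y
    proof
      show y: "y \<in> facelets n"
        using that by (auto simp: move_def slice_facelets_def split: if_splits)
      show "N - 1 \<le> height s y"
        using that move_outer[OF y, of s] by (auto split: if_splits)
    qed
    have "?F w \<noteq> w"
      using gx bij unfolding g_def x by (auto simp: bij_is_inj)
    then have w: "w \<in> facelets n" "N - 1 \<le> height Front w"
      using layer by auto
    have "N - 1 \<le> height Down x"
      using layer Dx by blast
    moreover obtain a b c where abc: "w = (a, b, c)"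
      by (cases w)
    \<comment> \<open>For nonzero \<open>a\<close> the right turn would carry the front-layer
      facelet \<open>w\<close> into the upper layer, which does not meet the bottom layer.\<close>
    ultimately have "a = 0"
      using w n3 by (cases "a = 0") (auto simp: x around_middle_def)
    then have "x = w"
      by (simp add: x around_middle_def abc)
    then have bc: "b \<le> 1 - N" "N - 1 \<le> c"
      using w \<open>N - 1 \<le> height Down x\<close> by (auto simp: abc)
    have "b = 1 - N \<and> c = N \<or> b = - N \<and> c = N - 1"
      using w(1) bc n3 unfolding abc \<open>a = 0\<close> facelets_iff by (elim disjE) auto
    then show ?thesis
      using n3 by (auto simp: \<open>x = w\<close> abc \<open>a = 0\<close> swap_outer_def)
  qed
  moreover have "apart DF DR" "apart DF UL" "apart DR UL"
    using V n3 by (auto simp: apart_def swap_outer_def)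
  ultimately have "realised DF (?D DF) (g DF)"
    by (intro realised_commutator G) (auto simp only: D g)
  then show ?thesis
    by (simp add: D g)
qed

text \<open>The third entry of the cycle \<open>DF DR UL\<close> is moved around by elements of
  \<open>G\<close> that fix \<open>DF\<close> and \<open>DR\<close>, until every facelet of the ten
  other single edges is reached.\<close>

lemma realised_base:
  assumes "apart c DF" "apart c DR"
  shows "realised DF DR c"
proof -
  have step: "realised DF DR (g x)" if "realised DF DR x" "g \<in> G" "g DF = DF" "g DR = DR" for g x
    using realised_image[OF that(2,1)] that(3,4) by simp
  let ?U = "move n Up (Suc 0)" and ?L = "move n Left (Suc 0)" and ?B = "move n Back (Suc 0)" and ?F = "move n Front (Suc 0)"
  \<comment> \<open>Upper, left and back turns never reach the edge between front and right.
    \<open>W\<close> brings the upper right edge there, and it fixes \<open>DF\<close> because the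
    inverse front turn moves \<open>DF\<close> out of reach of the upper turn.\<close>
  define W where "W = ?F \<circ> ?U \<circ> inv' ?F"
  have V: "DF \<in> V" "DR \<in> V"
    using n3 by (auto simp: V_iff)
  have fixed: "?U DF = DF" "?U DR = DR" "?L DF = DF" "?L DR = DR" "?B DF = DF" "?B DR = DR"
    using V n3 by (auto simp: move_V)
  have rU: "realised DF DR (?U x)" and rL: "realised DF DR (?L x)" and rB: "realised DF DR (?B x)"
    if "realised DF DR x" for x
    using step[OF that] fixed G_outer by blast+
  have inv_F: "inv' ?F x = y" if "x = ?F y" for x y
    by (rule inv_f_eq) (use that bij_is_inj[OF G_bij[OF G_outer]] in simp_all)
  have W: "W DF = DF" "W DR = DR"
    "W (N - 1, N, 0) = (N, 0, N - 1)" "W (N, N - 1, 0) = (N - 1, 0, N)"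
    using inv_F[of DF "(N - 1, 0, N)"] inv_F[of DR DR] inv_F[of "(N - 1, N, 0)" "(N - 1, N, 0)"]
      inv_F[of "(N, N - 1, 0)" "(N, N - 1, 0)"] n3
    by (simp_all add: W_def move_V V_iff)
  have "W \<in> G"
    unfolding W_def using G_outer G_comp G_inv by blast
  then have rW: "realised DF DR (W x)" if "realised DF DR x" for x
    using step[OF that] W by blast
  note r1 = realised_DF_DR_UL
  \<comment> \<open>A walk through the twenty facelets of these ten edges, each obtained from an
    earlier one by one of the four elements.\<close>
  have r2: "realised DF DR (0, N, 1 - N)"
    using rU[OF r1] n3 by (simp add: move_V V_iff)
  have r3: "realised DF DR (1 - N, 0, N)"
    using rL[OF r1] n3 by (simp add: move_V V_iff)
  have r4: "realised DF DR (N - 1, N, 0)"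
    using rU[OF r2] n3 by (simp add: move_V V_iff)
  have r5: "realised DF DR (- N, 0, 1 - N)"
    using rB[OF r2] n3 by (simp add: move_V V_iff)
  have r6: "realised DF DR (1 - N, - N, 0)"
    using rL[OF r3] n3 by (simp add: move_V V_iff)
  have r7: "realised DF DR (0, N, N - 1)"
    using rU[OF r4] n3 by (simp add: move_V V_iff)
  have r8: "realised DF DR (N, 0, N - 1)"
    using rW[OF r4] by (simp add: W)
  have r9: "realised DF DR (- N, N - 1, 0)"
    using rL[OF r5] n3 by (simp add: move_V V_iff)
  have r10: "realised DF DR (0, - N, 1 - N)"
    using rB[OF r5] n3 by (simp add: move_V V_iff)
  have r11: "realised DF DR (1 - N, 0, - N)"
    using rL[OF r6] n3 by (simp add: move_V V_iff)
  have r12: "realised DF DR (0, N - 1, - N)"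
    using rU[OF r9] n3 by (simp add: move_V V_iff)
  have r13: "realised DF DR (- N, 0, N - 1)"
    using rL[OF r9] n3 by (simp add: move_V V_iff)
  have r14: "realised DF DR (N, 0, 1 - N)"
    using rB[OF r10] n3 by (simp add: move_V V_iff)
  have r15: "realised DF DR (0, 1 - N, - N)"
    using rB[OF r11] n3 by (simp add: move_V V_iff)
  have r16: "realised DF DR (N, N - 1, 0)"
    using rU[OF r12] n3 by (simp add: move_V V_iff)
  have r17: "realised DF DR (- N, 1 - N, 0)"
    using rL[OF r13] n3 by (simp add: move_V V_iff)
  have r18: "realised DF DR (N - 1, 0, - N)"
    using rB[OF r15] n3 by (simp add: move_V V_iff)
  have r19: "realised DF DR (0, N - 1, N)"
    using rU[OF r16] n3 by (simp add: move_V V_iff)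
  have r20: "realised DF DR (N - 1, 0, N)"
    using rW[OF r16] by (simp add: W)
  obtain x y z where c: "c = (x, y, z)"
    by (cases c)
  have "c \<in> V"
    using assms by (simp add: apart_def)
  have ne: "c \<noteq> DF" "c \<noteq> opp DF" "c \<noteq> DR" "c \<noteq> opp DR"
    using apartD[OF assms(1)] apartD[OF assms(2)] by blast+
  have opp: "opp DF = (0, - N, N - 1)" "opp DR = (N - 1, - N, 0)"
    using n3 by (simp_all add: swap_outer_def)
  have pm: "\<bar>v\<bar> = N \<longleftrightarrow> v = N \<or> v = - N" "\<bar>v\<bar> = N - 1 \<longleftrightarrow> v = N - 1 \<or> v = 1 - N" for v
    using n3 by auto
  show ?thesis
    using \<open>c \<in> V\<close> ne unfolding c opp V_iff pm
    by (elim disjE conjE) (simp_all only: simp_thms r1 r2 r3 r4 r5 r6 r7 r8 r9 r10 r11 r12 r13 r14 r15 r16 r17 r18 r19 r20)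
qed

lemma card_V: "finite V" "card V > 8"
proof -
  show "finite V"
    using finite_facelets V_facelets by (meson finite_subset subsetI)
  have "{(0, N, N - 1), (0, N, 1 - N), (0, - N, N - 1), (0, - N, 1 - N), (N, 0, N - 1), (N, 0, 1 - N),
      (- N, 0, N - 1), (- N, 0, 1 - N), (N, N - 1, 0)} \<subseteq> V" (is "?W \<subseteq> _")
    using n3 by (auto simp: V_iff)
  moreover have "card ?W = 9"
    using n3 by simp
  ultimately show "card V > 8"
    using card_mono[OF \<open>finite V\<close>, of ?W] by simp
qed

lemma realised_if_apart:
  assumes "apart a b" "apart b c" "apart a c"
  shows "realised a b c"
proof (rule realised_all[of DF DR])
  show "apart DF DR"
    using n3 by (auto simp: apart_def V_iff)
qed (use realised_base card_V assms in auto)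


section \<open>Parity\<close>

lemma finite_dirs: "finite (edge_dirs \<union> corner_dirs)"
  by (simp add: edge_dirs_def corner_dirs_def)

lemma card_edge_dirs: "card edge_dirs = 12"
proof -
  have "edge_dirs = {(0, 1, 1), (0, 1, -1), (0, -1, 1), (0, -1, -1), (1, 0, 1), (1, 0, -1),
    (-1, 0, 1), (-1, 0, -1), (1, 1, 0), (1, -1, 0), (-1, 1, 0), (-1, -1, 0)}"
    unfolding edge_dirs_def by auto
  then show ?thesis
    by (rule ssubst) simp
qed

text \<open>An edge or corner direction has at most one zero coordinate, so the cubie has a facelet
  on a side orthogonal to the first or the second axis. Nonemptiness is what makes
  \<open>block\<close> injective.\<close>

lemma block_nonempty:
  assumes t: "t \<in> edge_dirs \<union> corner_dirs"
  shows "block t \<noteq> {}"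
proof -
  obtain i j k where ijk: "t = (i, j, k)"
    by (cases t)
  have c: "i = -1 \<or> i = 0 \<or> i = 1" "j = -1 \<or> j = 0 \<or> j = 1" "k = -1 \<or> k = 0 \<or> k = 1"
    and nz: "i \<noteq> 0 \<or> j \<noteq> 0"
    using t by (auto simp: ijk edge_dirs_def corner_dirs_def)
  have clamp: "clamp (N * l) = (N - 1) * l" "clamp ((N - 1) * l) = (N - 1) * l"
    "even ((N - 1) * l)" "\<bar>(N - 1) * l\<bar> \<le> N - 1" "l \<noteq> 0 \<Longrightarrow> \<bar>N * l\<bar> = N"
    if "l = -1 \<or> l = 0 \<or> l = 1" for l
    using that n3 odd_n by (auto simp: clamp_def)
  show ?thesis
  proof (cases "i = 0")
    case True
    then have "(0, N * j, (N - 1) * k) \<in> block t"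
      using clamp[OF c(2)] clamp[OF c(3)] clamp[of 0] n3 nz unfolding block_eq[OF t]
      by (simp add: ijk facelets_iff)
    then show ?thesis by blast
  next
    case False
    then have "(N * i, (N - 1) * j, (N - 1) * k) \<in> block t"
      using clamp[OF c(1)] clamp[OF c(2)] clamp[OF c(3)] unfolding block_eq[OF t]
      by (simp add: ijk facelets_iff)
    then show ?thesis by blast
  qed
qed

lemma scale_inj: "scale t = scale t' \<Longrightarrow> t = t'"
  using n3 by (cases t; cases t') auto

lemma block_disjoint:
  assumes "t \<in> edge_dirs \<union> corner_dirs" "t' \<in> edge_dirs \<union> corner_dirs"
    "p \<in> block t" "p \<in> block t'"
  shows "t = t'"
  by (rule scale_inj) (use assms(3,4) in \<open>simp add: block_eq[OF assms(1)] block_eq[OF assms(2)]\<close>)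

lemma block_inj: "inj_on block (edge_dirs \<union> corner_dirs)"
proof (rule inj_onI)
  fix t t' assume t: "t \<in> edge_dirs \<union> corner_dirs" "t' \<in> edge_dirs \<union> corner_dirs" "block t = block t'"
  then obtain p where "p \<in> block t"
    using block_nonempty by blast
  then show "t = t'"
    using block_disjoint t by simp
qed

lemma single_edges_card: "finite (single_edges n)" "card (single_edges n) = 12"
proof -
  show "finite (single_edges n)"
    unfolding single_edges_eq using finite_dirs by simp
  have "inj_on block edge_dirs"
    using block_inj by (rule inj_on_subset) auto
  then show "card (single_edges n) = 12"
    unfolding single_edges_eq by (simp add: card_image card_edge_dirs)
qed

text \<open>Edges and corners are taken together because an outer turn is a four-cycle, hence odd,
  on either kind alone.\<close>

definition block_action :: "(point \<Rightarrow> point) \<Rightarrow> point set \<Rightarrow> point set" where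
  "block_action g e = (if e \<in> block ` (edge_dirs \<union> corner_dirs) then g ` e else e)"

definition restricted_turn :: "face \<Rightarrow> point \<Rightarrow> point" where
  "restricted_turn s t = (if t \<in> edge_dirs \<union> corner_dirs then turn_dir s t else t)"

text \<open>On the ring of the eight edge and corner cubies of an outer layer, an eighth of a full turn
  makes sense as well: rotate by \<open>45\<close> degrees and project back onto the ring.\<close>

fun sgn_point :: "point \<Rightarrow> point \<Rightarrow> point" where
  "sgn_point (x, y, z) (x', y', z') = (sgn (x + x'), sgn (y + y'), sgn (z + z'))"

definition eighth_turn :: "face \<Rightarrow> point \<Rightarrow> point" where
  "eighth_turn s t = (if t \<in> edge_dirs \<union> corner_dirs \<and> height s t = 1
     then sgn_point t (quarter_turn s t) else t)"

lemma eighth_turn_in: "t \<in> edge_dirs \<union> corner_dirs \<Longrightarrow> eighth_turn s t \<in> edge_dirs \<union> corner_dirs"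
  by (cases s; cases t; simp only: edge_dirs_def corner_dirs_def Un_iff mem_Sigma_iff insert_iff empty_iff;
      elim disjE conjE; simp add: eighth_turn_def edge_dirs_def corner_dirs_def)

lemma eighth_turn_twice:
  "t \<in> edge_dirs \<union> corner_dirs \<Longrightarrow> eighth_turn s (eighth_turn s t) = turn_dir s t"
  by (cases s; cases t; simp only: edge_dirs_def corner_dirs_def Un_iff mem_Sigma_iff insert_iff empty_iff;
      elim disjE conjE; simp add: eighth_turn_def turn_dir_def edge_dirs_def corner_dirs_def)

text \<open>The square of a permutation is even, so this square root shows that the quarter turn is
  even without computing its cycles.\<close>

lemma restricted_turn_eq: "restricted_turn s = eighth_turn s \<circ> eighth_turn s"
proof
  fix t
  show "restricted_turn s t = (eighth_turn s \<circ> eighth_turn s) t"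
    using eighth_turn_twice[of t s]
    by (cases "t \<in> edge_dirs \<union> corner_dirs") (auto simp: restricted_turn_def eighth_turn_def)
qed

lemma eighth_turn_permutes: "eighth_turn s permutes edge_dirs \<union> corner_dirs"
proof (rule inj_imp_permutes[OF _ finite_dirs])
  show "inj_on (eighth_turn s) (edge_dirs \<union> corner_dirs)"
  proof (rule inj_onI)
    fix t t' assume "t \<in> edge_dirs \<union> corner_dirs" "t' \<in> edge_dirs \<union> corner_dirs"
      "eighth_turn s t = eighth_turn s t'"
    then have "turn_dir s t = turn_dir s t'"
      using eighth_turn_twice by metis
    moreover have "turn_dir s (turn_dir s (turn_dir s (turn_dir s u))) = u" for u
      by (simp add: turn_dir_def)
    ultimately show "t = t'"
      by metis
  qed
qed (use eighth_turn_in in \<open>auto simp: eighth_turn_def\<close>)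

lemma block_action_eq:
  assumes "\<And>t. t \<in> edge_dirs \<union> corner_dirs \<Longrightarrow> g ` block t = block (h t)"
  shows "block_action g = map_permutation (edge_dirs \<union> corner_dirs) block h"
proof
  fix e
  show "block_action g e = map_permutation (edge_dirs \<union> corner_dirs) block h e"
  proof (cases "e \<in> block ` (edge_dirs \<union> corner_dirs)")
    case True
    then obtain t where "t \<in> edge_dirs \<union> corner_dirs" "e = block t"
      by blast
    then show ?thesis
      using assms map_permutation_apply[OF block_inj] by (simp add: block_action_def)
  qed (simp add: block_action_def map_permutation_def)
qed

text \<open>Inner turns fix every block setwise, outer turns act as squares of eighth turns, and
  evenness passes to products.\<close>

lemma block_action_even:
  assumes "g \<in> G"
  shows "block_action g permutes block ` (edge_dirs \<union> corner_dirs) \<and> evenperm (block_action g)"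
  using assms
proof (induction rule: G_induct)
  case id
  have "block_action id = id"
    by (auto simp: block_action_def fun_eq_iff)
  then show ?case
    by (metis evenperm_id permutes_id)
next
  case (move s k)
  let ?D = "edge_dirs \<union> corner_dirs"
  have bij: "bij_betw block ?D (block ` ?D)"
    using block_inj by (rule inj_on_imp_bij_betw)
  define h where "h = (if k = 1 then restricted_turn s else id)"
  have "block_action (move n s k) = map_permutation ?D block h"
    by (rule block_action_eq) (use move_block[OF _ move] in \<open>auto simp: h_def restricted_turn_def\<close>)
  moreover have perm: "h permutes ?D"
    using permutes_compose[OF eighth_turn_permutes eighth_turn_permutes]
    by (auto simp: h_def restricted_turn_eq)
  moreover have "permutation (eighth_turn s)"
    by (rule permutes_imp_permutation[OF finite_dirs eighth_turn_permutes])
  then have "evenperm h"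
    by (auto simp: h_def restricted_turn_eq evenperm_comp)
  ultimately show ?case
    using map_permutation_permutes[OF bij perm] evenperm_map_permutation[OF block_inj perm finite_dirs]
    by simp
next
  case (comp g h)
  let ?B = "block ` (edge_dirs \<union> corner_dirs)"
  have "h ` e \<in> ?B" if "e \<in> ?B" for e
    using that permutes_in_image[OF conjunct1[OF comp(4)], of e] by (simp add: block_action_def)
  then have eq: "block_action (g \<circ> h) = block_action g \<circ> block_action h"
    by (fastforce simp: block_action_def image_comp)
  have "permutation (block_action g)" "permutation (block_action h)"
    using permutes_imp_permutation[OF finite_imageI[OF finite_dirs]] comp(3,4) by blast+
  then have "evenperm (block_action g \<circ> block_action h)"
    using evenperm_comp comp(3,4) by blast
  then show ?case
    unfolding eq using permutes_compose comp(3,4) by blast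
qed

section \<open>The single-edge subgroup\<close>

lemma single_edge_action_comp:
  assumes "h \<in> G"
  shows "single_edge_action n (g \<circ> h) = single_edge_action n g \<circ> single_edge_action n h"
proof
  fix e
  show "single_edge_action n (g \<circ> h) e = (single_edge_action n g \<circ> single_edge_action n h) e"
    using G_single_edges[OF assms] by (simp add: single_edge_action_def image_comp)
qed

lemma single_edge_action_permutes:
  assumes "g \<in> G"
  shows "single_edge_action n g permutes single_edges n"
proof (rule inj_imp_permutes[OF _ single_edges_card(1)])
  show "inj_on (single_edge_action n g) (single_edges n)"
    using permutes_inj[OF G_permutes[OF assms]]
    by (simp add: single_edge_action_def inj_on_def inj_image_eq_iff)
qed (use G_single_edges[OF assms] in \<open>simp_all add: single_edge_action_def\<close>)

lemma T_outside:
  assumes "a \<in> V" "b \<in> V" "c \<in> V" "x \<notin> V"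
  shows "T a b c x = x"
proof -
  have "x \<notin> set [a, b, c]" "x \<notin> set [opp a, opp b, opp c]"
    using assms opp_V(1) by auto
  then show ?thesis
    using id_outside_supp by (metis paired_cycle_def comp_apply)
qed

section \<open>Elements preserving the reference facelets\<close>

context
  fixes ref :: "point set \<Rightarrow> point"
  assumes ref: "\<forall>e \<in> single_edges n. ref e \<in> e"
begin

abbreviation E :: "(point \<Rightarrow> point) set" where
  "E \<equiv> single_edge_subgroup n ref"

lemma mem_E:
  "g \<in> E \<longleftrightarrow> g \<in> G \<and> (\<forall>f \<in> facelets n - V. g f = f) \<and>
     (\<forall>e \<in> single_edges n. g (ref e) \<in> ref ` single_edges n)"
  by (simp add: single_edge_subgroup_def single_edge_orientation_def V_def)

lemma ref_V: "e \<in> single_edges n \<Longrightarrow> ref e \<in> V"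
  using bspec[OF ref] by (auto simp: V_def)

lemma single_edge_ref: "e \<in> single_edges n \<Longrightarrow> e = {ref e, opp (ref e)}"
  by (rule single_edge_eq) (use ref in simp_all)

text \<open>Orientation zero only says that a reference facelet goes to some reference facelet.
  Disjointness of the single edges identifies it as the one of the image edge.\<close>

lemma E_ref:
  assumes "g \<in> E" "e \<in> single_edges n"
  shows "g (ref e) = ref (g ` e)"
proof -
  obtain e' where e': "e' \<in> single_edges n" "g (ref e) = ref e'"
    using assms mem_E by blast
  have "g ` e \<in> single_edges n" "g (ref e) \<in> g ` e"
    using assms ref G_single_edges mem_E by blast+
  then have "e' = g ` e"
    using e' ref single_edge_disjoint by metis
  then show ?thesis
    using e' by simp
qed

lemma subgroup_E: "subgroup E (cube_group n)"
proof (rule group.subgroupI[OF group_cube_group])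
  show "E \<subseteq> G"
    using mem_E by blast
  have "id \<in> E"
    using G_id by (simp add: mem_E)
  then show "E \<noteq> {}"
    by blast
next
  fix g h assume g: "g \<in> E" and h: "h \<in> E"
  have "g (h (ref e)) \<in> ref ` single_edges n" if e: "e \<in> single_edges n" for e
  proof -
    obtain e' where "e' \<in> single_edges n" "h (ref e) = ref e'"
      using h e mem_E by blast
    then show ?thesis
      using g mem_E by simp
  qed
  moreover have "g \<circ> h \<in> G"
    using G_comp g h mem_E by blast
  ultimately have "g \<circ> h \<in> E"
    using g h by (simp add: mem_E)
  then show "g \<otimes>\<^bsub>cube_group n\<^esub> h \<in> E"
    by simp
next
  fix g assume g: "g \<in> E"
  then have gG: "g \<in> G"
    by (simp add: mem_E)
  have inj: "inj g"
    using permutes_inj[OF G_permutes[OF gG]] .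
  \<comment> \<open>An injective self-map of a finite set is onto, so the inverse preserves the
    reference facelets too.\<close>
  have "g ` ref ` single_edges n = ref ` single_edges n"
  proof (rule endo_inj_surj)
    show "finite (ref ` single_edges n)"
      using single_edges_card(1) by simp
    show "g ` ref ` single_edges n \<subseteq> ref ` single_edges n"
      using g mem_E by blast
    show "inj_on g (ref ` single_edges n)"
      using inj by (rule inj_on_subset) simp
  qed
  then have "inv' g (ref e) \<in> ref ` single_edges n" if "e \<in> single_edges n" for e
    using that inj by (metis imageE image_eqI inv_f_f)
  moreover have "inv' g f = f" if "f \<in> facelets n - V" for f
    using g that inj by (simp add: mem_E inv_f_eq)
  ultimately show "inv\<^bsub>cube_group n\<^esub> g \<in> E"
    using gG G_inv by (simp add: mem_E inv_cube_group)
qed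

text \<open>Elements of \<open>E\<close> fix all corner facelets, so their joint action on edges and
  corners is just the action on single edges, extended by the identity.\<close>

lemma E_even:
  assumes "g \<in> E"
  shows "evenperm (single_edge_action n g)"
proof -
  have corner: "g ` block t = block t" if "t \<in> corner_dirs" for t
  proof -
    have "g p = p" if p: "p \<in> block t" for p
    proof -
      have "p \<notin> block t'" if t': "t' \<in> edge_dirs" for t'
        using block_disjoint[of t t' p] p t' \<open>t \<in> corner_dirs\<close>
        by (auto simp: edge_dirs_def corner_dirs_def)
      then have "p \<notin> V"
        by (auto simp: V_def single_edges_eq)
      moreover have "p \<in> facelets n"
        using p block_eq[of t] \<open>t \<in> corner_dirs\<close> by auto
      ultimately show ?thesis
        using assms by (simp add: mem_E)
    qed
    then show ?thesis
      by simp
  qed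
  have "block_action g e = single_edge_action n g e" for e
  proof (cases "e \<in> block ` corner_dirs")
    case True
    then have "g ` e = e"
      using corner by blast
    then show ?thesis
      by (simp add: block_action_def single_edge_action_def)
  next
    case False
    then show ?thesis
      by (simp add: block_action_def single_edge_action_def single_edges_eq image_Un)
  qed
  then have "block_action g = single_edge_action n g"
    by blast
  then show ?thesis
    using block_action_even[of g] assms mem_E by metis
qed

text \<open>The permutation of the edges determines the images of the reference facelets,
  commutation with \<open>opp\<close> then those of the other single-edge facelets, and everything
  else is fixed.\<close>

lemma E_action_inj: "inj_on (single_edge_action n) E"
proof (rule inj_onI)
  fix g h assume g: "g \<in> E" and h: "h \<in> E" and eq: "single_edge_action n g = single_edge_action n h"
  have "g x = h x" for x
  proof (cases "x \<in> V")
    case True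
    then obtain e where e: "e \<in> single_edges n" "x \<in> e"
      unfolding V_def by blast
    have "g ` e = h ` e"
      using fun_cong[OF eq, of e] e by (simp add: single_edge_action_def)
    then have ref_eq: "g (ref e) = h (ref e)"
      using E_ref[OF g e(1)] E_ref[OF h e(1)] by simp
    have gh: "g \<in> G" "h \<in> G"
      using g h mem_E by blast+
    have "g (opp (ref e)) = h (opp (ref e))"
      using G_opp[OF gh(1) ref_V[OF e(1)]] G_opp[OF gh(2) ref_V[OF e(1)]] ref_eq by simp
    moreover have "x = ref e \<or> x = opp (ref e)"
      using single_edge_ref[OF e(1)] e(2) by blast
    ultimately show ?thesis
      using ref_eq by blast
  next
    case False
    have fix_x: "k x = x" if "k \<in> E" for k
      using that False permutes_not_in[OF G_permutes, of k x] by (cases "x \<in> facelets n") (simp_all add: mem_E)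
    show ?thesis
      using fix_x[OF g] fix_x[OF h] by simp
  qed
  then show "g = h"
    by (rule ext)
qed

text \<open>The paired cycle through the three reference facelets permutes the set of all reference
  facelets, so it leaves every orientation zero.\<close>

lemma E_three_cycle:
  assumes e: "{e1, e2, e3} \<subseteq> single_edges n" and d: "distinct [e1, e2, e3]"
  shows "\<exists>g \<in> E. single_edge_action n g = cycle_of_list [e1, e2, e3]"
proof -
  have apart: "apart (ref e) (ref e')"
    if "e \<in> single_edges n" "e' \<in> single_edges n" "e \<noteq> e'" for e e'
    using that ref_V single_edge_ref ref single_edge_disjoint unfolding apart_def
    by (metis insertCI)
  have ap: "apart (ref e1) (ref e2)" "apart (ref e2) (ref e3)" "apart (ref e1) (ref e3)"
    using e d by (auto intro!: apart)
  define g where "g = T (ref e1) (ref e2) (ref e3)"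
  have gG: "g \<in> G"
    using realised_if_apart[OF ap] by (simp add: realised_def g_def)
  have g_ref: "g (ref e) = ref (cycle_of_list [e1, e2, e3] e)" if e': "e \<in> single_edges n" for e
  proof -
    consider "e = e1" | "e = e2" | "e = e3" | "e \<notin> {e1, e2, e3}"
      by blast
    then show ?thesis
    proof cases
      case 4
      then have "g (ref e) = ref e"
        unfolding g_def using e e' by (intro T_apply ap apart) auto
      then show ?thesis
        using 4 by (simp add: transpose_def)
    qed (use T_apply(1-3)[OF ap] d in \<open>auto simp: g_def transpose_def\<close>)
  qed
  have cyc: "cycle_of_list [e1, e2, e3] e \<in> single_edges n" if "e \<in> single_edges n" for e
    using that e by (auto simp: transpose_def)
  have "g \<in> E"
    using gG g_ref cyc e T_outside ref_V by (auto simp: mem_E g_def simp del: cycle_of_list.simps)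
  moreover have "single_edge_action n g x = cycle_of_list [e1, e2, e3] x" for x
  proof (cases "x \<in> single_edges n")
    case True
    have "g ` x = {g (ref x), g (opp (ref x))}"
      using single_edge_ref[OF True] by (metis image_empty image_insert)
    also have "\<dots> = {g (ref x), opp (g (ref x))}"
      using G_opp[OF gG ref_V[OF True]] by simp
    also have "\<dots> = cycle_of_list [e1, e2, e3] x"
      unfolding g_ref[OF True] by (rule single_edge_ref[OF cyc[OF True], symmetric])
    finally show ?thesis
      using True by (simp add: single_edge_action_def del: cycle_of_list.simps)
  next
    case False
    then show ?thesis
      using e by (auto simp: single_edge_action_def transpose_def)
  qed
  ultimately show ?thesis
    by blast
qed

lemma E_action_surj:
  assumes "p permutes single_edges n" "evenperm p"
  shows "\<exists>g \<in> E. single_edge_action n g = p"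
  using single_edges_card(1) assms
proof (induction rule: evenperm_three_cycle_induct)
  case id
  have "single_edge_action n id = id"
    by (auto simp: single_edge_action_def fun_eq_iff)
  then show ?case
    using subgroup.one_closed[OF subgroup_E] by (metis cube_group_simps(2))
next
  case (cycle e1 e2 e3)
  then show ?case
    by (rule E_three_cycle)
next
  case (comp p q)
  then obtain g h where "g \<in> E" "h \<in> E" "single_edge_action n g = p" "single_edge_action n h = q"
    by blast
  then show ?case
    using subgroup.m_closed[OF subgroup_E] single_edge_action_comp mem_E by (metis cube_group_simps(1))
qed

lemma E_iso:
  "single_edge_action n \<in> iso ((cube_group n)\<lparr>carrier := E\<rparr>) (alt_group_on (single_edges n))"
proof (rule isoI)
  have "single_edge_action n g permutes single_edges n" "evenperm (single_edge_action n g)"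
    if "g \<in> E" for g
    using that single_edge_action_permutes E_even mem_E by blast+
  then have maps: "single_edge_action n ` E \<subseteq> carrier (alt_group_on (single_edges n))"
    by (auto simp: alt_group_on_def)
  then show "single_edge_action n \<in> hom ((cube_group n)\<lparr>carrier := E\<rparr>) (alt_group_on (single_edges n))"
    using single_edge_action_comp mem_E
    by (auto simp: hom_def alt_group_on_def sym_group_on_def)
  have "carrier (alt_group_on (single_edges n)) \<subseteq> single_edge_action n ` E"
    using E_action_surj by (force simp: alt_group_on_def)
  then show "bij_betw (single_edge_action n) (carrier ((cube_group n)\<lparr>carrier := E\<rparr>))
      (carrier (alt_group_on (single_edges n)))"
    using E_action_inj maps by (auto simp: bij_betw_def)
qed

lemma E_is_iso: "(cube_group n)\<lparr>carrier := E\<rparr> \<cong> alt_group 12"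
proof -
  obtain f :: "nat \<Rightarrow> point set" where "bij_betw f {1..12} (single_edges n)"
    using ex_bij_betw_nat_finite_1[OF single_edges_card(1)] unfolding single_edges_card(2) by blast
  then have "bij_betw (inv_into {1..12} f) (single_edges n) {1..12}"
    by (rule bij_betw_inv_into)
  from map_permutation_iso_alt_group[OF this single_edges_card(1)] show ?thesis
    using iso_set_trans[OF E_iso] is_isoI by blast
qed

end

end

theorem theorem11:
  fixes n :: nat and ref :: "point set \<Rightarrow> point"
  assumes "n \<ge> 3" and "odd n"
    and "\<forall>e \<in> single_edges n. ref e \<in> e"
  shows "subgroup (single_edge_subgroup n ref) (cube_group n) \<and>
    single_edge_action n \<in>
      iso ((cube_group n)\<lparr>carrier := single_edge_subgroup n ref\<rparr>) (alt_group_on (single_edges n)) \<and>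
    (cube_group n)\<lparr>carrier := single_edge_subgroup n ref\<rparr> \<cong> alt_group 12"
proof -
  interpret odd_cube n
    using assms by unfold_locales auto
  show ?thesis
    using subgroup_E E_iso E_is_iso assms(3) by blast
qed

end
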